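(* Let $2\leq n\leq\infty$, let $\mathbb{F}_n$ be the free group of rank $n$, and let $(X,\mu)$ be a standard non-atomic Borel probability space. On the space $\mathrm{Fr}(\mathbb{F}_n,X)$ of almost everywhere free measure preserving actions of $\mathbb{F}_n$ on $(X,\mu)$, the equivalence relation relating two actions when the orbit equivalence relations they induce on $X$ are equal almost everywhere is not smooth.
   Context: $\mathcal{M}_\infty(X)$ is the group of measure preserving transformations (measure preserving Borel bijections, identified if equal almost everywhere) of $(X,\mu)$, a Polish group in the weak topology, whose basic neighborhoods of $T$ are $\{S:\mu(T(E_i)\triangle S(E_i))<\varepsilon,\ i\leq k\}$ for measurable $E_1,\dots,E_k\subseteq X$, $\varepsilon>0$. Measure preserving actions of $\mathbb{F}_n$ are identified with $n$-tuples (infinite sequences if $n=\infty$) in $\mathcal{M}_\infty(X)$, namely the images of the free generators, with the product topology. An action of a countable group $\Gamma$ is almost everywhere (a.e.) free if for every $\gamma\in\Gamma\setminus\{1\}$, $\gamma\cdot x\neq x$ for almost every $x$. $\mathrm{Fr}(\mathbb{F}_n,X)$ is the Borel set of those tuples giving a.e. free actions. Two equivalence relations $E,E'$ on $X$ are equal a.e. if there is a conull set $X_0\subseteq X$ such that $xEy\iff xE'y$ for all $x,y\in X_0$. An equivalence relation $E$ on a Polish (or standard Borel) space $Y$ is smooth (concretely classifiable) if there is a Borel function $f:Y\to 2^{\mathbb{N}}$ with $yEy'\iff f(y)=f(y')$ for all $y,y'\in Y$. *)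

theory Defs
  imports "HOL-Probability.Probability"
begin

definition non_atomic :: "'a measure \<Rightarrow> bool" where
  "non_atomic M \<longleftrightarrow>
    (\<forall>A\<in>sets M. emeasure M A > 0 \<longrightarrow>
       (\<exists>B\<in>sets M. B \<subseteq> A \<and> 0 < emeasure M B \<and> emeasure M B < emeasure M A))"

text \<open>A standard Borel space is represented by the Borel sets of a type of class
  \<^class>\<open>polish_space\<close>; only the Borel structure of the type enters below.\<close>

locale standard_nonatomic_prob_space = prob_space M for M :: "'a::polish_space measure" +
  assumes sets_borel: "sets M = sets borel"
    and non_atomic: "non_atomic M"


text \<open>In the following definitions the underlying space of \<open>M\<close> is the whole type \<open>'a\<close>.\<close>

definition mp_bijections :: "'a measure \<Rightarrow> ('a \<Rightarrow> 'a) set" where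
  "mp_bijections M =
    {T. bij T \<and> T \<in> measurable M M \<and> inv T \<in> measurable M M \<and> distr M M T = M}"

definition ae_eq :: "'a measure \<Rightarrow> (('a \<Rightarrow> 'a) \<times> ('a \<Rightarrow> 'a)) set" where
  "ae_eq M = {(S, T). S \<in> mp_bijections M \<and> T \<in> mp_bijections M \<and> (AE x in M. S x = T x)}"

definition MPT :: "'a measure \<Rightarrow> ('a \<Rightarrow> 'a) set set" where
  "MPT M = mp_bijections M // ae_eq M"

text \<open>A chosen representative of a class. Everything below that is defined through it is
  unaffected by the choice: changing countably many transformations on null sets
  changes images, fixed point sets and orbits only up to a null set.\<close>

definition rep :: "('a \<Rightarrow> 'a) set \<Rightarrow> 'a \<Rightarrow> 'a" where
  "rep C = (SOME T. T \<in> C)"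

definition weak_nbhd ::
    "'a measure \<Rightarrow> ('a \<Rightarrow> 'a) set \<Rightarrow> 'a set set \<Rightarrow> real \<Rightarrow> ('a \<Rightarrow> 'a) set set" where
  "weak_nbhd M T \<E> \<epsilon> =
    {S \<in> MPT M. \<forall>E\<in>\<E>. measure M ((rep T ` E - rep S ` E) \<union> (rep S ` E - rep T ` E)) < \<epsilon>}"

definition weak_topology :: "'a measure \<Rightarrow> ('a \<Rightarrow> 'a) set topology" where
  "weak_topology M = topology_generated_by
    {weak_nbhd M T \<E> \<epsilon> | T \<E> \<epsilon>. T \<in> MPT M \<and> finite \<E> \<and> \<E> \<subseteq> sets M \<and> \<epsilon> > 0}"


text \<open>The free generators of \<open>F\<^sub>n\<close> are indexed by \<open>generators n\<close>, which is all of
  \<open>\<nat>\<close> for \<open>n = \<infinity>\<close>. The elements of \<open>F\<^sub>n\<close> are the reduced words in letters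
  \<open>(i, True)\<close>, the \<open>i\<close>-th generator, and \<open>(i, False)\<close>, its inverse; the identity is the
  empty word.\<close>

definition generators :: "enat \<Rightarrow> nat set" where
  "generators n = {i. enat i < n}"

definition free_group :: "enat \<Rightarrow> (nat \<times> bool) list set" where
  "free_group n = {w. fst ` set w \<subseteq> generators n \<and>
     successively (\<lambda>(i, a) (j, b). i = j \<longrightarrow> a = b) w}"

definition actions :: "enat \<Rightarrow> 'a measure \<Rightarrow> (nat \<Rightarrow> ('a \<Rightarrow> 'a) set) topology" where
  "actions n M = product_topology (\<lambda>_. weak_topology M) (generators n)"

fun act :: "(nat \<Rightarrow> ('a \<Rightarrow> 'a) set) \<Rightarrow> (nat \<times> bool) list \<Rightarrow> 'a \<Rightarrow> 'a" where
  "act c [] x = x"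
| "act c ((i, b) # w) x = (if b then rep (c i) else inv (rep (c i))) (act c w x)"

definition Fr :: "enat \<Rightarrow> 'a measure \<Rightarrow> (nat \<Rightarrow> ('a \<Rightarrow> 'a) set) set" where
  "Fr n M = {c \<in> topspace (actions n M).
     \<forall>w\<in>free_group n. w \<noteq> [] \<longrightarrow> (AE x in M. act c w x \<noteq> x)}"

definition orbit_relation :: "enat \<Rightarrow> (nat \<Rightarrow> ('a \<Rightarrow> 'a) set) \<Rightarrow> ('a \<times> 'a) set" where
  "orbit_relation n c = {(x, y). \<exists>w\<in>free_group n. act c w x = y}"

definition rel_eq_ae :: "'a measure \<Rightarrow> ('a \<times> 'a) set \<Rightarrow> ('a \<times> 'a) set \<Rightarrow> bool" where
  "rel_eq_ae M E E' \<longleftrightarrow>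
    (\<exists>X\<^sub>0. (AE x in M. x \<in> X\<^sub>0) \<and> (\<forall>x\<in>X\<^sub>0. \<forall>y\<in>X\<^sub>0. (x, y) \<in> E \<longleftrightarrow> (x, y) \<in> E'))"

definition same_orbits :: "enat \<Rightarrow> 'a measure \<Rightarrow>
    ((nat \<Rightarrow> ('a \<Rightarrow> 'a) set) \<times> (nat \<Rightarrow> ('a \<Rightarrow> 'a) set)) set" where
  "same_orbits n M = {(c, d). c \<in> Fr n M \<and> d \<in> Fr n M \<and>
     rel_eq_ae M (orbit_relation n c) (orbit_relation n d)}"


definition borel_of :: "'b topology \<Rightarrow> 'b measure" where
  "borel_of T = sigma (topspace T) {U. openin T U}"

definition smooth :: "'b measure \<Rightarrow> ('b \<times> 'b) set \<Rightarrow> bool" where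
  "smooth Y R \<longleftrightarrow> (\<exists>f :: 'b \<Rightarrow> nat \<Rightarrow> bool. f \<in> borel_measurable Y \<and>
     (\<forall>y\<in>space Y. \<forall>y'\<in>space Y. (y, y') \<in> R \<longleftrightarrow> f y = f y'))"

end

theory Submission
  imports Defs
begin

text \<open>The proof builds a measurable family of free actions \<open>\<theta> y\<close>, indexed by coin tossing sequences
  \<open>y\<close>, such that changing finitely many bits of \<open>y\<close> does not change the orbits, whereas no fixed
  orbit relation is shared by almost all \<open>\<theta> y\<close>. A Borel function \<open>f\<close> classifying the actions up to
  equality of orbits would make \<open>f (\<theta> y)\<close> invariant under finite changes of \<open>y\<close>, hence almost
  surely constant by Kolmogorov's zero-one law, so almost all \<open>\<theta> y\<close> would have the same orbits.

  The family is \<open>\<theta> y = (a, b s\<^sub>y, b\<^sub>2, b\<^sub>3, \<dots>)\<close>, where only the second generator depends on \<open>y\<close> and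
  \<open>s\<^sub>y\<close> is the pointwise limit of the powers of \<open>a\<close> with exponents \<open>\<Sum>j<L. y\<^sub>j (j + 1)!\<close> as \<open>L\<close> grows.
  All these maps act on an infinite product of finite sets, coordinate by coordinate, by permutations.
  A permutation of a set of size at most \<open>L + 1\<close> has an order dividing \<open>(L + 1)!\<close>, so in each
  coordinate the exponents stabilise and \<open>s\<^sub>y\<close> makes sense. Three properties matter.

  \<^item> Setting the bit \<open>i\<close> multiplies \<open>s\<^sub>y\<close> by the genuine power \<open>a\<^bsup>(i+1)!\<^esup>\<close>, so the two tuples
    generate the same group and have the same orbits (\<open>gen_flip\<close>, \<open>gen_unflip\<close>).

  \<^item> For almost every \<open>z\<close> the map \<open>y \<mapsto> s\<^sub>y z\<close> is injective (\<open>gen_param_inj\<close>). If almost all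
    \<open>\<theta> y\<close> had the orbits of one \<open>\<theta> y\<^sub>0\<close>, then by Fubini some \<open>z\<close> would have \<open>b s\<^sub>y z\<close> in its
    countable \<open>\<theta> y\<^sub>0\<close>-orbit for almost all \<open>y\<close>, although points are null in the space of
    coin tosses (\<open>not_AE_same_orbits\<close>).

  \<^item> Each \<open>\<theta> y\<close> is free (\<open>gen_free\<close>). The coordinates are indexed by words \<open>w\<close> (with an auxiliary
    shift and infinitely many repetitions), and for a reduced word \<open>w\<close> there are permutations of
    \<open>{0, \<dots>, length w}\<close> along which \<open>w\<close> moves \<open>0\<close> through \<open>1, 2, \<dots>\<close> to \<open>length w\<close>. The shift
    compensates for \<open>s\<^sub>y\<close>. Hence \<open>w\<close> moves a fixed proportion of the points in infinitely many
    independent coordinates, and almost every point of the product is moved.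

  The product is carried to the given space by an isomorphism modulo null sets
  (\<open>iso_mod0_polish_Baire\<close>), and \<open>y \<mapsto> \<theta> y\<close> becomes continuous for the weak topology, because
  a measurable set is almost determined by finitely many coordinates (\<open>PiM_pmf_small_change\<close>).\<close>

section \<open>Isomorphisms modulo null sets\<close>

definition iso_mod0 :: "'a measure \<Rightarrow> 'b measure \<Rightarrow> ('a \<Rightarrow> 'b) \<Rightarrow> ('b \<Rightarrow> 'a) \<Rightarrow> bool" where
  "iso_mod0 M N \<phi> \<psi> \<longleftrightarrow> \<phi> \<in> measurable M N \<and> \<psi> \<in> measurable N M \<and>
     distr M N \<phi> = N \<and> distr N M \<psi> = M \<and>
     (AE x in M. \<psi> (\<phi> x) = x) \<and> (AE z in N. \<phi> (\<psi> z) = z)"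

lemma iso_mod0_sym: "iso_mod0 M N \<phi> \<psi> \<Longrightarrow> iso_mod0 N M \<psi> \<phi>"
  by (auto simp: iso_mod0_def)

lemma AE_mp_compose:
  assumes "f \<in> measurable M N" "distr M N f = N" "AE z in N. Q z"
  shows "AE x in M. Q (f x)"
  by (rule AE_distrD[OF assms(1)]) (simp only: assms)

lemma iso_mod0_trans:
  assumes "iso_mod0 M N \<phi> \<psi>" "iso_mod0 N K \<alpha> \<beta>"
  shows "iso_mod0 M K (\<alpha> \<circ> \<phi>) (\<psi> \<circ> \<beta>)"
proof -
  have m: "\<phi> \<in> measurable M N" "\<psi> \<in> measurable N M" "\<alpha> \<in> measurable N K" "\<beta> \<in> measurable K N"
    and d: "distr M N \<phi> = N" "distr N M \<psi> = M" "distr N K \<alpha> = K" "distr K N \<beta> = N"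
    and a: "AE x in M. \<psi> (\<phi> x) = x" "AE z in N. \<phi> (\<psi> z) = z"
      "AE x in N. \<beta> (\<alpha> x) = x" "AE z in K. \<alpha> (\<beta> z) = z"
    using assms by (auto simp: iso_mod0_def)
  have "distr M K (\<alpha> \<circ> \<phi>) = K" "distr K M (\<psi> \<circ> \<beta>) = M"
    using distr_distr[OF m(3,1)] distr_distr[OF m(2,4)] d by simp_all
  moreover have "AE x in M. (\<psi> \<circ> \<beta>) ((\<alpha> \<circ> \<phi>) x) = x"
    using AE_mp_compose[OF m(1) d(1) a(3)] a(1) by eventually_elim simp
  moreover have "AE x in K. (\<alpha> \<circ> \<phi>) ((\<psi> \<circ> \<beta>) x) = x"
    using AE_mp_compose[OF m(4) d(4) a(2)] a(4) by eventually_elim simp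
  ultimately show ?thesis using m by (auto simp: iso_mod0_def)
qed

text \<open>One direction suffices: pushing \<open>\<psi> (\<phi> x) = x\<close> forward along \<open>\<phi>\<close> gives the remaining conditions,
  provided that the set on which \<open>\<phi> (\<psi> z) = z\<close> is measurable.\<close>
lemma iso_mod0I:
  assumes "\<phi> \<in> measurable M N" "\<psi> \<in> measurable N M" "distr M N \<phi> = N"
    and inv: "AE x in M. \<psi> (\<phi> x) = x"
    and eq: "{z \<in> space N. \<phi> (\<psi> z) = z} \<in> sets N"
  shows "iso_mod0 M N \<phi> \<psi>"
proof -
  have "distr N M \<psi> = distr (distr M N \<phi>) M \<psi>" using assms(3) by simp
  also have "\<dots> = distr M M (\<psi> \<circ> \<phi>)" by (rule distr_distr[OF assms(2,1)])
  also have "\<dots> = distr M M (\<lambda>x. x)"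
    using assms(1,2) inv by (intro distr_cong_AE) (auto simp: comp_def)
  also have "\<dots> = M" by simp
  finally have "distr N M \<psi> = M" .
  moreover
  have "AE z in distr M N \<phi>. \<phi> (\<psi> z) = z"
    by (subst AE_distr_iff[OF assms(1) eq]) (use inv in eventually_elim, simp)
  then have "AE z in N. \<phi> (\<psi> z) = z" by (simp only: assms)
  ultimately show ?thesis using assms by (simp add: iso_mod0_def)
qed

abbreviation unit_interval :: "real measure" where
  "unit_interval \<equiv> restrict_space lborel {0<..<1}"

text \<open>With digits \<open>0\<close> and \<open>1\<close> in base \<open>3\<close> the tail after position \<open>n\<close> is at most half a unit, so no carry
  occurs and the integer part determines the digits. Only its parity is needed, and as \<open>3\<close> is odd
  this is the parity of the number of digits \<open>1\<close>.\<close>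
lemma digit_sum_recovers:
  fixes d :: "nat \<Rightarrow> bool"
  defines "s \<equiv> (\<Sum>k. of_bool (d k) * (1/3::real) ^ k)"
  shows "odd \<lfloor>3 ^ n * s\<rfloor> \<longleftrightarrow> odd (\<Sum>k\<le>n. (of_bool (d k) :: int))"
proof -
  let ?f = "\<lambda>k. of_bool (d k) * (1/3::real) ^ k"
  have le: "?f k \<le> (1/3) ^ k" "0 \<le> ?f k" for k by auto
  have g: "summable (\<lambda>k. (1/3::real) ^ k)" by (rule summable_geometric) simp
  have sm: "summable ?f" by (rule summable_comparison_test'[OF g]) auto
  have split: "s = (\<Sum>k. ?f (k + Suc n)) + (\<Sum>k<Suc n. ?f k)"
    unfolding s_def by (rule suminf_split_initial_segment[OF sm])
  have sm2: "summable (\<lambda>k. ?f (k + Suc n))" by (rule summable_ignore_initial_segment[OF sm])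
  have g2: "summable (\<lambda>k. (1/3::real) ^ (k + Suc n))" by (rule summable_ignore_initial_segment[OF g])
  have tail_le: "(\<Sum>k. ?f (k + Suc n)) \<le> (\<Sum>k. (1/3::real) ^ (k + Suc n))"
    using le by (intro suminf_le sm2 g2) blast
  also have "\<dots> = (\<Sum>k. (1/3)^Suc n * (1/3::real) ^ k)" by (simp add: power_add mult.commute)
  also have "\<dots> = (1/3)^Suc n * (3/2)"
    using suminf_mult[OF g, of "(1/3)^Suc n"] suminf_geometric[of "1/3::real"] by simp
  finally have t1: "3 ^ n * (\<Sum>k. ?f (k + Suc n)) \<le> 1/2"
    by (simp add: field_simps power_one_over)
  have t0: "0 \<le> 3 ^ n * (\<Sum>k. ?f (k + Suc n))"
    using le by (intro mult_nonneg_nonneg suminf_nonneg sm2) auto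
  have "3 ^ n * (\<Sum>k<Suc n. ?f k) = (\<Sum>k\<le>n. 3 ^ n * ?f k)"
    by (simp only: sum_distrib_left lessThan_Suc_atMost)
  also have "\<dots> = (\<Sum>k\<le>n. of_bool (d k) * 3 ^ (n - k))"
    by (intro sum.cong) (auto simp: power_one_over power_diff)
  also have "\<dots> = of_int (\<Sum>k\<le>n. of_bool (d k) * 3 ^ (n - k))" by simp
  finally have eq: "3 ^ n * s = of_int (\<Sum>k\<le>n. of_bool (d k) * 3 ^ (n - k)) + 3 ^ n * (\<Sum>k. ?f (k + Suc n))"
    unfolding split by (simp only: distrib_left add.commute)
  have fl: "\<lfloor>3 ^ n * s\<rfloor> = (\<Sum>k\<le>n. of_bool (d k) * 3 ^ (n - k))"
  proof (rule floor_unique)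
    show "of_int (\<Sum>k\<le>n. of_bool (d k) * 3 ^ (n - k)) \<le> 3 ^ n * s" using eq t0 by simp
    show "3 ^ n * s < of_int (\<Sum>k\<le>n. of_bool (d k) * 3 ^ (n - k)) + 1"
      unfolding eq using t1 by (intro add_strict_left_mono) simp
  qed
  have "{..n} \<inter> Collect d = {a. a \<le> n \<and> d a}" by auto
  then show ?thesis unfolding fl by (simp add: even_sum_iff)
qed

text \<open>The graph of \<open>z\<close>, a subset of \<open>\<nat> \<times> \<nat>\<close>, is coded as a sequence of digits in base \<open>3\<close>. The left
  inverse reads the graph back, without any need to know that the image of the coding is Borel.\<close>
lemma Baire_space_retract_of_real:
  "\<exists>\<phi> \<psi>. \<phi> \<in> borel_measurable (PiM UNIV (\<lambda>_::nat. count_space (UNIV::nat set))) \<and>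
     \<psi> \<in> measurable borel (PiM UNIV (\<lambda>_::nat. count_space (UNIV::nat set))) \<and>
     (\<forall>z. \<psi> (\<phi> z :: real) = z)"
proof (intro exI conjI allI)
  let ?B = "PiM UNIV (\<lambda>_::nat. count_space (UNIV::nat set))"
  define d where "d z k = (z (fst (prod_decode k)) = snd (prod_decode k))" for z :: "nat \<Rightarrow> nat" and k
  define \<phi> where "\<phi> z = (\<Sum>k. of_bool (d z k) * (1/3::real) ^ k)" for z
  \<comment> \<open>Consecutive partial sums of digits differ in parity exactly when the digit is \<open>1\<close>.\<close>
  define V where "V k r = (odd \<lfloor>3 ^ k * r :: real\<rfloor> \<noteq> (k > 0 \<and> odd \<lfloor>3 ^ (k-1) * r\<rfloor>))" for k r
  define \<psi> where "\<psi> r m = (LEAST j. V (prod_encode (m, j)) r)" for r m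
  have [measurable]: "Measurable.pred borel (V k)" for k
    unfolding V_def by measurable
  have [measurable]: "Measurable.pred ?B (\<lambda>z. d z k)" for k
    unfolding d_def by measurable
  show "\<phi> \<in> borel_measurable ?B" unfolding \<phi>_def by measurable
  show "\<psi> \<in> measurable borel ?B"
    unfolding \<psi>_def by (rule measurable_PiM_single') auto
  have V: "V k (\<phi> z) = d z k" for k z
  proof -
    define S where "S n = (\<Sum>k\<le>n. (of_bool (d z k) :: int))" for n
    have "S 0 = of_bool (d z 0)" "S (Suc n) = S n + of_bool (d z (Suc n))" for n
      unfolding S_def by (simp_all only: sum.atMost_Suc atMost_0) simp
    then show ?thesis
      unfolding V_def \<phi>_def digit_sum_recovers S_def[symmetric] by (cases k) auto
  qed
  show "\<psi> (\<phi> z) = z" for z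
    by (auto simp: \<psi>_def V d_def fun_eq_iff intro!: Least_equality)
qed

text \<open>A point is coded by the first members of a dense sequence that approximate it up to \<open>2\<^sup>-\<^sup>k\<close>,
  and it is recovered as their limit.\<close>
lemma polish_retract_of_Baire_space:
  "\<exists>\<alpha> \<beta>. \<alpha> \<in> measurable borel (PiM UNIV (\<lambda>_::nat. count_space (UNIV::nat set))) \<and>
     \<beta> \<in> measurable (PiM UNIV (\<lambda>_::nat. count_space (UNIV::nat set))) borel \<and>
     (\<forall>x::'a::polish_space. \<beta> (\<alpha> x) = x)"
proof -
  let ?B = "PiM UNIV (\<lambda>_::nat. count_space (UNIV::nat set))"
  obtain D :: "'a set" where D: "countable D" "\<And>X. open X \<Longrightarrow> X \<noteq> {} \<Longrightarrow> \<exists>d\<in>D. d \<in> X"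
    using countable_dense_exists[where 'a='a] by blast
  from D(2)[of UNIV] have "D \<noteq> {}" by auto
  define q where "q = from_nat_into D"
  have q: "\<exists>j. dist (q j) x < (1/2)^k" for x k
  proof -
    obtain d where "d \<in> D" "dist x d < (1/2)^k" using D(2)[of "ball x ((1/2)^k)"]
      by (metis centre_in_ball empty_iff mem_ball open_ball zero_less_divide_1_iff zero_less_numeral zero_less_power)
    moreover obtain j where "q j = d" using from_nat_into_surj[OF D(1) \<open>d \<in> D\<close>] unfolding q_def by blast
    ultimately show ?thesis by (auto simp: dist_commute)
  qed
  define \<alpha> where "\<alpha> x k = (LEAST j. dist (q j) x < (1/2)^k)" for x k
  have \<alpha>: "dist (q (\<alpha> x k)) x < (1/2)^k" for x k
    unfolding \<alpha>_def by (rule LeastI_ex[OF q])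
  \<comment> \<open>Made constant off the set of convergence, so that measurability of the limit follows.\<close>
  define \<beta>' where "\<beta>' i z = (if Cauchy (\<lambda>k. q (z k)) then q (z i) else q 0)" for i z
  define \<beta> where "\<beta> z = lim (\<lambda>i. \<beta>' i z)" for z
  have [measurable]: "(\<lambda>z. q (z k)) \<in> borel_measurable ?B" for k
    by (rule measurable_compose[OF measurable_component_singleton]) auto
  have [measurable]: "Measurable.pred ?B (\<lambda>z. Cauchy (\<lambda>k. q (z k)))"
    using sets_Collect_Cauchy[of "\<lambda>i z. q (z i)" ?B] by (simp add: pred_def)
  show ?thesis
  proof (intro exI conjI allI)
    show "\<alpha> \<in> measurable borel ?B"
      unfolding \<alpha>_def by (rule measurable_PiM_single') auto
    show "\<beta> \<in> borel_measurable ?B"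
    proof (rule borel_measurable_LIMSEQ_metric)
      show "\<beta>' i \<in> borel_measurable ?B" for i unfolding \<beta>'_def by measurable
      fix z
      have "convergent (\<lambda>i. \<beta>' i z)"
        unfolding \<beta>'_def by (cases "Cauchy (\<lambda>k. q (z k))") (auto simp: Cauchy_convergent convergent_const)
      then show "(\<lambda>i. \<beta>' i z) \<longlonglongrightarrow> \<beta> z" unfolding \<beta>_def by (simp add: convergent_LIMSEQ_iff)
    qed
    fix x :: 'a
    have "(\<lambda>k. dist (q (\<alpha> x k)) x) \<longlonglongrightarrow> 0"
    proof (rule tendsto_sandwich[of "\<lambda>_. 0"])
      show "(\<lambda>k. (1/2::real)^k) \<longlonglongrightarrow> 0" by (rule LIMSEQ_realpow_zero) auto
    qed (use \<alpha> in \<open>auto intro!: always_eventually less_imp_le\<close>)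
    then have l: "(\<lambda>k. q (\<alpha> x k)) \<longlonglongrightarrow> x" by (rule tendsto_dist_iff[THEN iffD2])
    then have "(\<lambda>i. \<beta>' i (\<alpha> x)) = (\<lambda>k. q (\<alpha> x k))"
      using LIMSEQ_imp_Cauchy[OF l] by (auto simp: \<beta>'_def)
    then show "\<beta> (\<alpha> x) = x" using l limI by (auto simp: \<beta>_def)
  qed
qed

text \<open>The left inverse \<open>\<psi>\<close> identifies \<open>M\<close> with the law \<open>\<mu>\<close> of \<open>\<phi>\<close> on the line. As \<open>\<mu>\<close> has no atoms, its
  distribution function is continuous and hence inverse to the quantile function, which carries
  Lebesgue measure to \<open>\<mu>\<close>.\<close>
lemma iso_mod0_unit_interval:
  assumes "prob_space M" and null: "\<And>x. x \<in> space M \<Longrightarrow> emeasure M {x} = 0"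
    and \<phi>: "\<phi> \<in> borel_measurable M" and \<psi>: "\<psi> \<in> measurable borel M"
    and ret: "\<And>x. x \<in> space M \<Longrightarrow> \<psi> (\<phi> x :: real) = x"
  shows "\<exists>f g. iso_mod0 M unit_interval f g"
proof -
  interpret M: prob_space M by fact
  define \<mu> where "\<mu> = distr M borel \<phi>"
  have s\<mu>: "sets \<mu> = sets borel" "space \<mu> = UNIV" by (auto simp: \<mu>_def)
  interpret \<mu>: cdf_distribution \<mu>
    using M.real_distribution_distr[OF \<phi>] by (simp add: cdf_distribution_def \<mu>_def)
  have "iso_mod0 M \<mu> \<phi> \<psi>"
  proof (rule iso_mod0I)
    show "\<phi> \<in> measurable M \<mu>" "\<psi> \<in> measurable \<mu> M" using \<phi> \<psi> by (auto simp: \<mu>_def)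
    then have *: "(\<lambda>z. \<phi> (\<psi> z)) \<in> borel_measurable \<mu>" using measurable_compose \<phi> by blast
    show "distr M \<mu> \<phi> = \<mu>" by (simp add: \<mu>_def cong: distr_cong)
    show "AE x in M. \<psi> (\<phi> x) = x" using ret by auto
    have "(\<lambda>z. z) \<in> borel_measurable \<mu>" by (simp add: \<mu>_def)
    with * show "{z \<in> space \<mu>. \<phi> (\<psi> z) = z} \<in> sets \<mu>"
      by (rule measurable_equality_set)
  qed
  \<comment> \<open>The value \<open>1/2\<close> keeps the distribution function inside the open interval where it is \<open>0\<close> or \<open>1\<close>.\<close>
  moreover have "iso_mod0 unit_interval \<mu> \<mu>.I (\<lambda>r. if 0 < \<mu>.C r \<and> \<mu>.C r < 1 then \<mu>.C r else 1/2)"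
    (is "iso_mod0 _ _ _ ?C")
  proof (rule iso_mod0I)
    have "measure \<mu> {r} = 0" for r
    proof -
      have "\<phi> -` {r} \<inter> space M \<subseteq> {\<psi> r}" using ret by auto
      moreover have "\<psi> r \<in> space M" using measurable_space[OF \<psi>, of r] by simp
      ultimately have "\<phi> -` {r} \<inter> space M = {} \<or> \<phi> -` {r} \<inter> space M = {\<psi> r} \<and> \<psi> r \<in> space M" by auto
      then have "emeasure M (\<phi> -` {r} \<inter> space M) = 0" using null by auto
      then have "emeasure \<mu> {r} = 0" by (simp add: \<mu>_def emeasure_distr \<phi>)
      then show ?thesis by (simp add: measure_def)
    qed
    then have cont: "isCont \<mu>.C r" for r by (simp add: \<mu>.isCont_cdf)
    have CI: "\<mu>.C (\<mu>.I w) = w" if w: "0 < w" "w < 1" for w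
    proof (rule antisym)
      show ge: "w \<le> \<mu>.C (\<mu>.I w)" using \<mu>.pseudoinverse[of w "\<mu>.I w"] w by simp
      have "\<mu>.C r \<le> w" if "r < \<mu>.I w" for r
        using \<mu>.pseudoinverse[of w r] w that by linarith
      then have "\<forall>\<^sub>F r in at_left (\<mu>.I w). \<mu>.C r \<le> w"
        unfolding eventually_at_filter by (intro always_eventually) auto
      moreover have "(\<mu>.C \<longlongrightarrow> \<mu>.C (\<mu>.I w)) (at_left (\<mu>.I w))"
        using cont[of "\<mu>.I w"] by (simp add: continuous_at_imp_continuous_within continuous_within filterlim_at_split)
      ultimately show "\<mu>.C (\<mu>.I w) \<le> w" by (intro tendsto_upperbound) auto
    qed
    show I: "\<mu>.I \<in> measurable unit_interval \<mu>"
      using \<mu>.measurable_CI by (simp add: s\<mu> cong: measurable_cong_sets) 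
    show C: "?C \<in> measurable \<mu> unit_interval"
      by (rule measurable_restrict_space2) (auto simp: s\<mu> cong: measurable_cong_sets)
    show "distr unit_interval \<mu> \<mu>.I = \<mu>" using \<mu>.distr_I_eq_M by (simp add: s\<mu> cong: distr_cong)
    show "AE x in unit_interval. ?C (\<mu>.I x) = x"
      by (rule AE_I2) (auto simp: space_restrict_space CI)
    have "(\<lambda>z. \<mu>.I (?C z)) \<in> borel_measurable \<mu>"
      using measurable_compose[OF C I] by (simp add: s\<mu> cong: measurable_cong_sets)
    moreover have "(\<lambda>z. z) \<in> borel_measurable \<mu>" by simp
    ultimately show "{z \<in> space \<mu>. \<mu>.I (?C z) = z} \<in> sets \<mu>" by (rule measurable_equality_set)
  qed
  ultimately show ?thesis using iso_mod0_trans[OF _ iso_mod0_sym] by blast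
qed

text \<open>The isomorphism theorem for standard non-atomic probability spaces in the form needed here.
  Working modulo null sets avoids any statement about Borel images of injective Borel maps.\<close>
lemma iso_mod0_polish_Baire:
  fixes M :: "'a::polish_space measure" and N :: "(nat \<Rightarrow> nat) measure"
  assumes M: "prob_space M" "sets M = sets borel" "\<And>x. emeasure M {x} = 0"
    and N: "prob_space N" "sets N = sets (PiM UNIV (\<lambda>_. count_space UNIV))" "\<And>z. emeasure N {z} = 0"
  shows "\<exists>\<phi> \<psi>. iso_mod0 M N \<phi> \<psi>"
proof -
  let ?B = "PiM UNIV (\<lambda>_::nat. count_space (UNIV::nat set))"
  obtain f g where fg: "f \<in> borel_measurable ?B" "g \<in> measurable borel ?B" "\<And>z. g (f z :: real) = z"
    using Baire_space_retract_of_real by blast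
  obtain \<alpha> \<beta> where ab: "\<alpha> \<in> measurable borel ?B" "\<beta> \<in> measurable ?B borel" "\<And>x::'a. \<beta> (\<alpha> x) = x"
    using polish_retract_of_Baire_space by blast
  obtain f1 g1 where 1: "iso_mod0 M unit_interval f1 g1"
    using iso_mod0_unit_interval[OF M(1,3), of "f \<circ> \<alpha>" "\<beta> \<circ> g"] fg ab
      measurable_comp[OF ab(1) fg(1)] measurable_comp[OF fg(2) ab(2)]
    by (auto simp: M(2) cong: measurable_cong_sets)
  obtain f2 g2 where 2: "iso_mod0 N unit_interval f2 g2"
    using iso_mod0_unit_interval[OF N(1,3), of f g] fg
    by (auto simp: N(2) cong: measurable_cong_sets)
  show ?thesis using iso_mod0_trans[OF 1 iso_mod0_sym[OF 2]] by blast
qed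

section \<open>Measure preserving bijections and words\<close>

lemma mp_bijectionsD:
  assumes "T \<in> mp_bijections M"
  shows "bij T" "T \<in> measurable M M" "inv T \<in> measurable M M" "distr M M T = M"
  using assms by (auto simp: mp_bijections_def)

lemma mp_bijections_inv:
  assumes "T \<in> mp_bijections M" shows "inv T \<in> mp_bijections M"
proof -
  note T = mp_bijectionsD[OF assms]
  have "distr M M (inv T) = distr (distr M M T) M (inv T)" using T(4) by simp
  also have "\<dots> = distr M M (inv T \<circ> T)" by (rule distr_distr[OF T(3,2)])
  also have "inv T \<circ> T = (\<lambda>x. x)" using bij_is_inj[OF T(1)] by (auto simp: fun_eq_iff)
  finally have "distr M M (inv T) = M" by simp
  then show ?thesis using T by (auto simp: mp_bijections_def bij_imp_bij_inv inv_inv_eq)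
qed

lemma mp_bijections_comp:
  assumes "S \<in> mp_bijections M" "T \<in> mp_bijections M" shows "S \<circ> T \<in> mp_bijections M"
proof -
  note S = mp_bijectionsD[OF assms(1)] and T = mp_bijectionsD[OF assms(2)]
  have "distr M M (S \<circ> T) = M" using distr_distr[OF S(2) T(2)] S(4) T(4) by simp
  then show ?thesis
    using S T by (auto simp: mp_bijections_def bij_comp o_inv_distrib intro: measurable_comp)
qed

lemma mp_bijections_id: "(\<lambda>x. x) \<in> mp_bijections M"
proof -
  have "inv (\<lambda>x::'a. x) = (\<lambda>x. x)" by (rule inv_equality) auto
  then show ?thesis by (simp add: mp_bijections_def bij_def inj_on_def)
qed

lemma AE_mp_bijection:
  assumes "T \<in> mp_bijections M" "AE x in M. Q x" shows "AE x in M. Q (T x)"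
  using mp_bijectionsD(2,4)[OF assms(1)] assms(2) by (rule AE_mp_compose)

lemma AE_inv_eq:
  assumes "S \<in> mp_bijections M" "T \<in> mp_bijections M" "AE x in M. S x = T x"
  shows "AE x in M. inv S x = inv T x"
  using AE_mp_bijection[OF mp_bijections_inv[OF assms(2)] assms(3)]
proof eventually_elim
  case (elim x)
  then have "S (inv T x) = x"
    using mp_bijectionsD(1)[OF assms(2)] by (simp add: bij_is_surj surj_f_inv_f)
  then show ?case using mp_bijectionsD(1)[OF assms(1)] by (metis bij_is_inj inv_f_f)
qed

definition ae_class :: "'a measure \<Rightarrow> ('a \<Rightarrow> 'a) \<Rightarrow> ('a \<Rightarrow> 'a) set" where
  "ae_class M T = ae_eq M `` {T}"

lemma ae_class_in_MPT: "T \<in> mp_bijections M \<Longrightarrow> ae_class M T \<in> MPT M"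
  unfolding MPT_def ae_class_def by (rule quotientI)

lemma rep_in_mp_bijections:
  assumes "C \<in> MPT M" shows "rep C \<in> mp_bijections M"
proof -
  obtain T where T: "T \<in> mp_bijections M" "C = ae_eq M `` {T}"
    using assms unfolding MPT_def by (auto elim: quotientE)
  then have "T \<in> C" by (auto simp: ae_eq_def)
  then have "rep C \<in> C" unfolding rep_def by (rule someI[of "\<lambda>T. T \<in> C"])
  then show ?thesis using T by (auto simp: ae_eq_def)
qed

lemma AE_rep_ae_class:
  assumes "T \<in> mp_bijections M" shows "AE x in M. rep (ae_class M T) x = T x"
proof -
  have "T \<in> ae_class M T" using assms by (auto simp: ae_class_def ae_eq_def)
  then have "rep (ae_class M T) \<in> ae_class M T"
    unfolding rep_def by (rule someI[of "\<lambda>S. S \<in> ae_class M T"])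
  then show ?thesis by (auto simp: ae_class_def ae_eq_def)
qed

lemma AE_funpow_invariant:
  assumes "S \<in> measurable M M" "distr M M S = M" "AE x in M. Q x"
  shows "AE x in M. \<forall>k. Q ((S ^^ k) x)"
  unfolding AE_all_countable
proof
  show "AE x in M. Q ((S ^^ k) x)" for k
  proof (induction k)
    case (Suc k)
    show ?case unfolding funpow_Suc_right o_def
      using AE_mp_compose[OF assms(1,2) Suc] .
  qed (use assms(3) in simp)
qed

text \<open>Elements of \<open>mp_bijections\<close> must be bijective everywhere. The points all of whose forward
  and backward iterates behave well form an invariant conull set \<open>G\<close>, on which \<open>S\<close> and \<open>S'\<close> are
  inverse to each other; off \<open>G\<close> the identity is used.\<close>
lemma mp_bijection_of_AE_inverse:
  fixes M :: "'a::polish_space measure"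
  assumes M: "sets M = sets borel"
    and S: "S \<in> measurable M M" "distr M M S = M"
    and S': "S' \<in> measurable M M" "distr M M S' = M"
    and inv: "AE x in M. S' (S x) = x" "AE x in M. S (S' x) = x"
  shows "\<exists>T\<in>mp_bijections M. AE x in M. T x = S x"
proof -
  have sp: "space M = UNIV" using sets_eq_imp_space_eq[OF M] by simp
  define D where "D x \<longleftrightarrow> S' (S x) = x \<and> S (S' x) = x" for x
  define G where "G x \<longleftrightarrow> (\<forall>k. D ((S ^^ k) x)) \<and> (\<forall>k. D ((S' ^^ k) x))" for x
  have [measurable]: "S \<in> measurable M M" "S' \<in> measurable M M" by fact+
  have eqm: "Measurable.pred M (\<lambda>x. f x = g x)" if "f \<in> measurable M M" "g \<in> measurable M M" for f g
    using measurable_equality_set[of f M g] that M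
    by (simp add: pred_def cong: measurable_cong_sets)
  have "Measurable.pred M (\<lambda>x. S' (S x) = x)" "Measurable.pred M (\<lambda>x. S (S' x) = x)"
    by (rule eqm; measurable)+
  then have Dm [measurable]: "Measurable.pred M D" unfolding D_def by measurable
  have [measurable]: "S ^^ k \<in> measurable M M" "S' ^^ k \<in> measurable M M" for k
    by (induction k) (auto simp: id_def intro!: measurable_comp S(1) S'(1))
  have Gm [measurable]: "Measurable.pred M G" unfolding G_def by measurable
  have "AE x in M. D x" using inv by eventually_elim (simp add: D_def)
  from AE_funpow_invariant[OF S this] AE_funpow_invariant[OF S' this]
  have AEG: "AE x in M. G x" by eventually_elim (simp add: G_def)
  have GD: "D x" if "G x" for x using that unfolding G_def by (metis funpow_0)
  have GS: "G (S x)" if "G x" for x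
    unfolding G_def
  proof (intro conjI allI)
    show "D ((S ^^ k) (S x))" for k
      using that unfolding G_def by (metis funpow_swap1 funpow.simps(2) comp_apply)
    show "D ((S' ^^ k) (S x))" for k
    proof (cases k)
      case 0
      then show ?thesis using that unfolding G_def by (metis funpow_0 funpow_simps_right(2) comp_apply)
    next
      case (Suc j)
      then have "(S' ^^ k) (S x) = (S' ^^ j) x" using GD[OF that] by (simp add: funpow_swap1 D_def)
      then show ?thesis using that unfolding G_def by simp
    qed
  qed
  have GS': "G (S' x)" if "G x" for x
    unfolding G_def
  proof (intro conjI allI)
    show "D ((S' ^^ k) (S' x))" for k
      using that unfolding G_def by (metis funpow_swap1 funpow.simps(2) comp_apply)
    show "D ((S ^^ k) (S' x))" for k
    proof (cases k)
      case 0
      then show ?thesis using that unfolding G_def by (metis funpow_0 funpow_simps_right(2) comp_apply)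
    next
      case (Suc j)
      then have "(S ^^ k) (S' x) = (S ^^ j) x" using GD[OF that] by (simp add: funpow_swap1 D_def)
      then show ?thesis using that unfolding G_def by simp
    qed
  qed
  define T where "T x = (if G x then S x else x)" for x
  define T' where "T' x = (if G x then S' x else x)" for x
  have TT: "T' (T x) = x" "T (T' x) = x" for x
    using GS GS' GD by (auto simp: T_def T'_def D_def)
  have bij: "bij T" by (rule bij_betw_byWitness[of _ T']) (use TT in auto)
  have invT: "inv T = T'" by (rule inv_equality) (use TT in auto)
  have T: "T \<in> measurable M M" "T' \<in> measurable M M" unfolding T_def T'_def by measurable
  have AET: "AE x in M. T x = S x" using AEG by eventually_elim (simp add: T_def)
  have "distr M M T = distr M M S" using T S AET by (intro distr_cong_AE) auto
  then show ?thesis using bij T AET S(2) by (intro bexI[of _ T]) (auto simp: mp_bijections_def invT)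
qed

lemma lift_along_iso_mod0:
  fixes M :: "'a::polish_space measure"
  assumes M: "sets M = sets borel" and iso: "iso_mod0 M N \<phi> \<psi>" and t: "t \<in> mp_bijections N"
  shows "\<exists>T\<in>mp_bijections M. AE x in M. \<phi> (T x) = t (\<phi> x)"
proof -
  have \<phi>: "\<phi> \<in> measurable M N" "distr M N \<phi> = N" and \<psi>: "\<psi> \<in> measurable N M" "distr N M \<psi> = M"
    and \<psi>\<phi>: "AE x in M. \<psi> (\<phi> x) = x" and \<phi>\<psi>: "AE z in N. \<phi> (\<psi> z) = z"
    using iso by (auto simp: iso_mod0_def)
  define S where "S s = \<psi> \<circ> (s \<circ> \<phi>)" for s
  have S: "S s \<in> measurable M M" "distr M M (S s) = M" if "s \<in> mp_bijections N" for s
  proof -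
    note s = mp_bijectionsD[OF that]
    have s\<phi>: "s \<circ> \<phi> \<in> measurable M N" using \<phi> s by (auto intro: measurable_comp)
    then show "S s \<in> measurable M M" unfolding S_def using \<psi> by (auto intro: measurable_comp)
    have "distr M N (s \<circ> \<phi>) = N" using distr_distr[OF s(2) \<phi>(1)] \<phi>(2) s(4) by simp
    then show "distr M M (S s) = M" unfolding S_def
      using distr_distr[OF \<psi>(1) s\<phi>] \<psi>(2) by simp
  qed
  have \<phi>S: "AE x in M. \<phi> (S s x) = s (\<phi> x)" if "s \<in> mp_bijections N" for s
    unfolding S_def o_def by (rule AE_mp_compose[OF \<phi> AE_mp_bijection[OF that \<phi>\<psi>]])
  have inv: "AE x in M. S s' (S s x) = x"
    if "s \<in> mp_bijections N" "s' \<in> mp_bijections N" "\<And>z. s' (s z) = z" for s s'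
    using \<phi>S[OF that(1)] \<psi>\<phi> by eventually_elim (simp add: S_def that(3))
  have "\<exists>T\<in>mp_bijections M. AE x in M. T x = S t x"
  proof (rule mp_bijection_of_AE_inverse[OF M])
    have t': "inv t \<in> mp_bijections N" by (rule mp_bijections_inv[OF t])
    note b = mp_bijectionsD(1)[OF t]
    show "S t \<in> measurable M M" "distr M M (S t) = M"
      "S (inv t) \<in> measurable M M" "distr M M (S (inv t)) = M" using S t t' by auto
    show "AE x in M. S (inv t) (S t x) = x" "AE x in M. S t (S (inv t) x) = x"
      using b by (auto intro!: inv t t' simp: bij_is_inj bij_is_surj surj_f_inv_f)
  qed
  then obtain T where T: "T \<in> mp_bijections M" "AE x in M. T x = S t x" by blast
  have "AE x in M. \<phi> (T x) = t (\<phi> x)" using T(2) \<phi>S[OF t] by eventually_elim simp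
  then show ?thesis using T by blast
qed


text \<open>The function \<open>act\<close> for arbitrary transformations in place of chosen representatives, so that words can
  be evaluated in the model and inside a single coordinate.\<close>
fun wact :: "(nat \<Rightarrow> 'x \<Rightarrow> 'x) \<Rightarrow> (nat \<times> bool) list \<Rightarrow> 'x \<Rightarrow> 'x" where
  "wact t [] x = x"
| "wact t ((i, b) # w) x = (if b then t i else inv (t i)) (wact t w x)"

lemma act_eq_wact: "act c w = wact (\<lambda>i. rep (c i)) w"
proof
  show "act c w x = wact (\<lambda>i. rep (c i)) w x" for x by (induction w) auto
qed

lemma wact_append: "wact t (u @ w) x = wact t u (wact t w x)"
  by (induction u) auto

lemma wact_mp_bijections:
  assumes "\<And>i. i \<in> fst ` set w \<Longrightarrow> t i \<in> mp_bijections M"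
  shows "wact t w \<in> mp_bijections M"
  using assms
proof (induction w)
  case Nil
  then show ?case using mp_bijections_id[of M] by (simp add: wact.simps(1)[abs_def])
next
  case (Cons l w)
  obtain i b where l: "l = (i, b)" by force
  have eq: "wact t (l # w) = (if b then t i else inv (t i)) \<circ> wact t w"
    by (auto simp: fun_eq_iff l)
  have "t i \<in> mp_bijections M" "wact t w \<in> mp_bijections M" using Cons by (auto simp: l)
  then show ?case unfolding eq by (intro mp_bijections_comp) (simp add: mp_bijections_inv)
qed

definition inverse_word :: "(nat \<times> bool) list \<Rightarrow> (nat \<times> bool) list" where
  "inverse_word w = rev (map (\<lambda>(i, b). (i, \<not> b)) w)"

lemma fst_set_inverse_word: "fst ` set (inverse_word w) = fst ` set w"
  by (force simp: inverse_word_def)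

lemma wact_inverse_word:
  assumes "\<And>i. i \<in> fst ` set w \<Longrightarrow> bij (t i)"
  shows "wact t (inverse_word w) (wact t w x) = x"
  using assms
proof (induction w arbitrary: x)
  case (Cons l w)
  obtain i b where l: "l = (i, b)" by force
  then have "bij (t i)" using Cons.prems by auto
  then show ?case using Cons
    by (auto simp: inverse_word_def l wact_append bij_is_inj bij_is_surj surj_f_inv_f)
qed (simp add: inverse_word_def)

definition reduced_word :: "(nat \<times> bool) list \<Rightarrow> bool" where
  "reduced_word w \<longleftrightarrow> successively (\<lambda>(i, a) (j, b). i = j \<longrightarrow> a = b) w"

lemma free_group_eq: "free_group n = {w. fst ` set w \<subseteq> generators n \<and> reduced_word w}"
  by (simp add: free_group_def reduced_word_def)

lemma exists_reduced_word:
  assumes "\<And>i. i \<in> fst ` set w \<Longrightarrow> bij (t i)"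
  shows "\<exists>w'. fst ` set w' \<subseteq> fst ` set w \<and> reduced_word w' \<and> wact t w' = wact t w"
  using assms
proof (induction w)
  case Nil
  then show ?case by (intro exI[of _ "[]"]) (simp add: reduced_word_def)
next
  case (Cons l w)
  then obtain w' where w': "fst ` set w' \<subseteq> fst ` set w" "reduced_word w'" "wact t w' = wact t w"
    by auto
  obtain i b where l: "l = (i, b)" by force
  then have b: "bij (t i)" using Cons.prems by auto
  show ?case
  proof (cases "\<exists>w''. w' = (i, \<not> b) # w''")
    case True
    then obtain w'' where w'': "w' = (i, \<not> b) # w''" by blast
    have "wact t (l # w) x = wact t w'' x" for x
      using b w'(3)[symmetric] by (simp add: l w'' bij_is_inj bij_is_surj surj_f_inv_f)
    then show ?thesis using w' by (intro exI[of _ w'']) (auto simp: w'' reduced_word_def successively_Cons)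
  next
    case False
    have "wact t (l # w) x = wact t (l # w') x" for x using w'(3) by (simp add: l)
    moreover have "reduced_word (l # w')"
      using w'(2) False by (cases w') (auto simp: reduced_word_def l)
    ultimately show ?thesis using w'(1) by (intro exI[of _ "l # w'"]) auto
  qed
qed

text \<open>Almost everywhere relations between generators pass to words, since each transformation
  preserves null sets.\<close>
lemma AE_wact_intertwine:
  assumes \<phi>: "\<phi> \<in> measurable M N" "distr M N \<phi> = N"
    and c: "\<And>i. i \<in> fst ` set w \<Longrightarrow> c i \<in> mp_bijections M"
    and t: "\<And>i. i \<in> fst ` set w \<Longrightarrow> bij (t i)"
    and ct: "\<And>i. i \<in> fst ` set w \<Longrightarrow> AE x in M. \<phi> (c i x) = t i (\<phi> x)"
  shows "AE x in M. \<phi> (wact c w x) = wact t w (\<phi> x)"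
  using c t ct
proof (induction w)
  case (Cons l w)
  obtain i b where l: "l = (i, b)" by force
  have ci: "c i \<in> mp_bijections M" and ti: "bij (t i)" and cti: "AE x in M. \<phi> (c i x) = t i (\<phi> x)"
    using Cons.prems by (auto simp: l)
  have w: "wact c w \<in> mp_bijections M" using Cons.prems by (intro wact_mp_bijections) auto
  have IH: "AE x in M. \<phi> (wact c w x) = wact t w (\<phi> x)" using Cons by auto
  have inv: "AE x in M. \<phi> (inv (c i) x) = inv (t i) (\<phi> x)"
    using AE_mp_bijection[OF mp_bijections_inv[OF ci] cti]
  proof eventually_elim
    case (elim x)
    have "c i (inv (c i) x) = x" using mp_bijectionsD(1)[OF ci] by (simp add: bij_is_surj surj_f_inv_f)
    then show ?case using elim ti by (simp add: bij_is_inj)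
  qed
  show ?case
  proof (cases b)
    case True
    show ?thesis using AE_mp_bijection[OF w cti] IH by eventually_elim (simp add: l True)
  next
    case False
    show ?thesis using AE_mp_bijection[OF w inv] IH by eventually_elim (simp add: l False)
  qed
qed simp

text \<open>If each generator of \<open>d\<close> agrees almost everywhere with a word in \<open>c\<close>, the orbits of \<open>d\<close> are contained
  in those of \<open>c\<close> off a single null set, because there are only countably many words.\<close>
lemma AE_orbit_subset:
  assumes c: "\<And>i. i \<in> I \<Longrightarrow> c i \<in> mp_bijections M" and d: "\<And>i. i \<in> I \<Longrightarrow> d i \<in> mp_bijections M"
    and sub: "\<And>i. i \<in> I \<Longrightarrow> fst ` set (sub i) \<subseteq> I"
    and dc: "\<And>i. i \<in> I \<Longrightarrow> AE x in M. d i x = wact c (sub i) x"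
  shows "AE x in M. \<forall>w. fst ` set w \<subseteq> I \<longrightarrow>
    (\<exists>w'. fst ` set w' \<subseteq> I \<and> reduced_word w' \<and> wact c w' x = wact d w x)"
  unfolding AE_all_countable
proof
  have ex: "\<exists>w'. fst ` set w' \<subseteq> I \<and> (AE x in M. wact d w x = wact c w' x)"
    if "fst ` set w \<subseteq> I" for w
    using that
  proof (induction w)
    case Nil
    then show ?case by (intro exI[of _ "[]"]) simp
  next
    case (Cons l w)
    then obtain w' where w': "fst ` set w' \<subseteq> I" "AE x in M. wact d w x = wact c w' x" by auto
    obtain i b where l: "l = (i, b)" by force
    then have i: "i \<in> I" and wI: "fst ` set w \<subseteq> I" using Cons.prems by auto
    have wd: "wact d w \<in> mp_bijections M" using d wI by (intro wact_mp_bijections) auto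
    define u where "u = (if b then sub i else inverse_word (sub i))"
    have uI: "fst ` set u \<subseteq> I" using sub[OF i] by (simp add: u_def fst_set_inverse_word)
    have "AE x in M. (if b then d i else inv (d i)) x = wact c u x"
    proof (cases b)
      case False
      have s: "wact c (sub i) \<in> mp_bijections M" using c sub[OF i] by (intro wact_mp_bijections) auto
      have "inv (wact c (sub i)) = wact c (inverse_word (sub i))"
      proof (rule inv_equality)
        show *: "wact c (inverse_word (sub i)) (wact c (sub i) x) = x" for x
          using c sub[OF i] mp_bijectionsD(1) by (intro wact_inverse_word) blast
        show "wact c (sub i) (wact c (inverse_word (sub i)) x) = x" for x
          using *[of "inv (wact c (sub i)) x"] mp_bijectionsD(1)[OF s]
          by (simp add: bij_is_surj surj_f_inv_f)
      qed
      then show ?thesis using AE_inv_eq[OF d[OF i] s dc[OF i]] False by (simp add: u_def)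
    qed (use dc[OF i] in \<open>simp add: u_def\<close>)
    from AE_mp_bijection[OF wd this] w'(2)
    have "AE x in M. wact d (l # w) x = wact c (u @ w') x"
      by eventually_elim (simp add: l wact_append)
    then show ?case using uI w'(1) by (intro exI[of _ "u @ w'"]) auto
  qed
  fix w
  show "AE x in M. fst ` set w \<subseteq> I \<longrightarrow>
    (\<exists>w'. fst ` set w' \<subseteq> I \<and> reduced_word w' \<and> wact c w' x = wact d w x)"
  proof (cases "fst ` set w \<subseteq> I")
    case True
    then obtain w' where w': "fst ` set w' \<subseteq> I" "AE x in M. wact d w x = wact c w' x" using ex by blast
    obtain w'' where w'': "fst ` set w'' \<subseteq> fst ` set w'" "reduced_word w''" "wact c w'' = wact c w'"
      using exists_reduced_word[of w' c] w'(1) c mp_bijectionsD(1) by blast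
    show ?thesis using w'(2)
    proof eventually_elim
      case (elim x)
      then show ?case using w' w'' by (intro impI exI[of _ w'']) auto
    qed
  qed auto
qed

section \<open>The combinatorial family of permutations\<close>

lemma inj_on_extends_to_permutation:
  assumes S: "finite S" "D \<subseteq> S" "f ` D \<subseteq> S" and inj: "inj_on f D"
  shows "\<exists>p. p permutes S \<and> (\<forall>x\<in>D. p x = f x)"
proof -
  have "card (S - D) = card (S - f ` D)"
    using S inj by (simp add: card_Diff_subset finite_subset card_image)
  then obtain g where g: "bij_betw g (S - D) (S - f ` D)"
    using finite_same_card_bij[of "S - D" "S - f ` D"] S(1) by auto
  define p where "p x = (if x \<in> D then f x else if x \<in> S then g x else x)" for x
  have "bij_betw p D (f ` D)"
    using inj_on_imp_bij_betw[OF inj] by (rule bij_betw_cong[THEN iffD1, rotated]) (simp add: p_def)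
  moreover have "bij_betw p (S - D) (S - f ` D)"
    using g by (rule bij_betw_cong[THEN iffD1, rotated]) (simp add: p_def)
  ultimately have "bij_betw p (D \<union> (S - D)) (f ` D \<union> (S - f ` D))"
    by (rule bij_betw_combine) auto
  moreover have "D \<union> (S - D) = S" "f ` D \<union> (S - f ` D) = S" using S by auto
  ultimately have "p permutes S"
    using S by (intro bij_imp_permutes) (auto simp: p_def)
  then show ?thesis by (intro exI[of _ p]) (simp add: p_def)
qed

text \<open>Reading \<open>w\<close> from the right, the step from \<open>t\<close> to \<open>t + 1\<close> is labelled by the letter \<open>l t\<close>. Each
  generator is thereby prescribed on a part \<open>D i\<close> of \<open>{0, \<dots>, length w}\<close>. Consistency and injectivity
  of these prescriptions could fail only at a point where a letter meets its inverse, which does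
  not happen in a reduced word. A partial injection of a finite set extends to a permutation.\<close>
lemma reduced_word_path_permutations:
  assumes w: "reduced_word w"
  shows "\<exists>\<sigma>. (\<forall>i. \<sigma> i permutes {..length w}) \<and>
    (\<forall>t\<le>length w. wact \<sigma> (drop (length w - t) w) 0 = t)"
proof -
  define L where "L = length w"
  define l where "l t = w ! (L - Suc t)" for t
  have red: "b = b'" if "Suc t < L" "l t = (i, b)" "l (Suc t) = (i, b')" for t i b b'
  proof -
    have "(\<lambda>(i, a) (j, b). i = j \<longrightarrow> a = b) (w ! (L - Suc (Suc t))) (w ! Suc (L - Suc (Suc t)))"
      using w that(1) unfolding reduced_word_def L_def successively_conv_nth by auto
    moreover have "Suc (L - Suc (Suc t)) = L - Suc t" using that(1) by simp
    ultimately show ?thesis using that by (simp add: l_def)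
  qed
  define D where "D i = {t. t < L \<and> l t = (i, True)} \<union> {Suc t | t. t < L \<and> l t = (i, False)}" for i
  define f where "f i x = (if x < L \<and> l x = (i, True) then Suc x else x - 1)" for i x
  have f_back: "f i (Suc t) = t" if "t < L" "l t = (i, False)" for i t
    using red[of t i False True] that by (auto simp: f_def)
  have inj: "inj_on (f i) (D i)" for i
  proof (rule inj_onI)
    fix x y assume xy: "x \<in> D i" "y \<in> D i" "f i x = f i y"
    have no: False if "t < L" "l t = (i, True)" "s < L" "l s = (i, False)" "f i t = f i (Suc s)" for t s
    proof -
      have "s = Suc t" using that f_back[OF that(3,4)] by (simp add: f_def)
      then show False using red[of t i True False] that by simp
    qed
    show "x = y" using xy no unfolding D_def
      by (auto simp: f_back) (auto simp: f_def split: if_splits)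
  qed
  have "\<exists>p. p permutes {..L} \<and> (\<forall>x\<in>D i. p x = f i x)" for i
    by (rule inj_on_extends_to_permutation[OF _ _ _ inj]) (auto simp: D_def f_def)
  then obtain \<sigma> where \<sigma>: "\<And>i. \<sigma> i permutes {..L}" "\<And>i x. x \<in> D i \<Longrightarrow> \<sigma> i x = f i x" by metis
  have "wact \<sigma> (drop (L - t) w) 0 = t" if "t \<le> L" for t
    using that
  proof (induction t)
    case (Suc t)
    obtain i b where ib: "l t = (i, b)" by force
    have "L - Suc t < length w" using Suc.prems by (simp add: L_def)
    then have "drop (L - Suc t) w = l t # drop (Suc (L - Suc t)) w"
      unfolding l_def by (simp add: Cons_nth_drop_Suc)
    moreover have "Suc (L - Suc t) = L - t" using Suc.prems by simp
    ultimately have dr: "drop (L - Suc t) w = (i, b) # drop (L - t) w" using ib by simp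
    have IH: "wact \<sigma> (drop (L - t) w) 0 = t" using Suc by simp
    show ?case
    proof (cases b)
      case True
      then have "\<sigma> i t = Suc t" using ib Suc.prems \<sigma>(2)[of t i] by (simp add: D_def f_def)
      then show ?thesis using dr IH True by simp
    next
      case False
      then have "\<sigma> i (Suc t) = t"
        using ib Suc.prems \<sigma>(2)[of "Suc t" i] f_back[of t i] by (auto simp: D_def)
      then have "inv (\<sigma> i) t = Suc t" using permutes_inverses(2)[OF \<sigma>(1)[of i], of "Suc t"] by simp
      then show ?thesis using dr IH False by simp
    qed
  qed (simp add: L_def)
  then show ?thesis using \<sigma>(1) by (auto simp: L_def)
qed

definition path_perm :: "(nat \<times> bool) list \<Rightarrow> nat \<Rightarrow> nat \<Rightarrow> nat" where
  "path_perm w = (SOME \<sigma>. (\<forall>i. \<sigma> i permutes {..length w}) \<and>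
     (reduced_word w \<longrightarrow> (\<forall>t\<le>length w. wact \<sigma> (drop (length w - t) w) 0 = t)))"

lemma path_perm:
  shows path_perm_permutes: "path_perm w i permutes {..length w}"
    and path_perm_path: "reduced_word w \<Longrightarrow> t \<le> length w \<Longrightarrow>
      wact (path_perm w) (drop (length w - t) w) 0 = t"
proof -
  have "\<exists>\<sigma>. (\<forall>i. \<sigma> i permutes {..length w}) \<and>
     (reduced_word w \<longrightarrow> (\<forall>t\<le>length w. wact \<sigma> (drop (length w - t) w) 0 = t))"
  proof (cases "reduced_word w")
    case False
    then show ?thesis using permutes_id[of "{..length w}"] by (intro exI[of _ "\<lambda>_. id"]) simp
  qed (use reduced_word_path_permutations[of w] in simp)
  then have P: "(\<forall>i. path_perm w i permutes {..length w}) \<and>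
     (reduced_word w \<longrightarrow> (\<forall>t\<le>length w. wact (path_perm w) (drop (length w - t) w) 0 = t))"
    unfolding path_perm_def by (rule someI_ex)
  show "path_perm w i permutes {..length w}" using P by simp
  show "wact (path_perm w) (drop (length w - t) w) 0 = t" if "reduced_word w" "t \<le> length w"
    using P that by simp
qed

lemma funpow_mult_fixpoint: "(f ^^ k) x = x \<Longrightarrow> (f ^^ (k * n)) x = x"
  by (induction n) (auto simp: funpow_add)

lemma funpow_fact_permutes:
  assumes p: "p permutes S" and S: "finite S" "card S \<le> n" and d: "fact n dvd d"
  shows "(p ^^ d) x = x"
proof (cases "x \<in> S")
  case False
  then have "p x = x" using p by (simp add: permutes_not_in)
  then show ?thesis using funpow_mult_fixpoint[of 1 p x d] by simp
next
  case True
  have in_S: "(p ^^ k) x \<in> S" for k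
    using True permutes_in_image[OF p] by (induction k) auto
  have "card ((\<lambda>k. (p ^^ k) x) ` {..n}) \<le> card S" using in_S S by (intro card_mono) auto
  then have "\<not> inj_on (\<lambda>k. (p ^^ k) x) {..n}" using S(2) by (intro pigeonhole) simp
  then obtain i j where ij: "i < j" "j \<le> n" "(p ^^ i) x = (p ^^ j) x"
  proof -
    assume *: "\<And>i j. i < j \<Longrightarrow> j \<le> n \<Longrightarrow> (p ^^ i) x = (p ^^ j) x \<Longrightarrow> thesis"
      and "\<not> inj_on (\<lambda>k. (p ^^ k) x) {..n}"
    then obtain i j where "i \<le> n" "j \<le> n" "(p ^^ i) x = (p ^^ j) x" "i \<noteq> j"
      unfolding inj_on_def by auto
    then show thesis using *[of i j] *[of j i] by (cases "i < j") auto
  qed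
  have "(p ^^ i) ((p ^^ (j - i)) x) = (p ^^ i) x"
    using ij funpow_add[of i "j - i" p] by (simp add: fun_eq_iff)
  then have "(p ^^ (j - i)) x = x"
    using inj_fn[OF permutes_inj[OF p], of i] by (auto dest: injD)
  moreover have "(j - i) dvd d"
    using dvd_trans[OF dvd_fact d, of "j - i"] ij by simp
  ultimately show ?thesis using funpow_mult_fixpoint by (metis dvdE)
qed

lemma funpow_cyclic_permutation:
  assumes p: "p permutes {..L}" and path: "\<And>t. t \<le> L \<Longrightarrow> (p ^^ t) 0 = t" and x: "x \<le> L"
  shows "(p ^^ d) x = (x + d) mod Suc L"
proof -
  have step: "p y = Suc y" if "y < L" for y
    using path[of y] path[of "Suc y"] that by simp
  have L: "p L = 0"
  proof (rule ccontr)
    assume "p L \<noteq> 0"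
    moreover have "p L \<in> {..L}" using permutes_in_image[OF p, of L] by simp
    ultimately obtain y where y: "p L = Suc y" "y < L" by (cases "p L") auto
    then have "p L = p y" using step by simp
    then show False using permutes_inj[OF p] y by (auto dest: injD)
  qed
  show ?thesis
  proof (induction d)
    case (Suc d)
    define r where "r = (x + d) mod Suc L"
    have "r \<le> L" unfolding r_def using mod_less_divisor[of "Suc L" "x + d"] by linarith
    then have "p r = Suc r mod Suc L" using step[of r] L by (cases "r = L") auto
    then show ?case using Suc unfolding r_def by (simp add: mod_Suc_eq)
  qed (use x in simp)
qed

text \<open>The factorials play the role of a mixed radix system: the sum determines its bits, and modulo
  \<open>(L + 1)!\<close> the omitted terms vanish.\<close>
definition twist_exponent :: "nat \<Rightarrow> (nat \<Rightarrow> bool) \<Rightarrow> nat" where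
  "twist_exponent L y = (\<Sum>j<L. if y j then fact (Suc j) else 0)"

lemma twist_exponent_flip:
  "twist_exponent L (y(i := True)) =
     twist_exponent L (y(i := False)) + (if i < L then fact (Suc i) else 0)"
proof (induction L)
  case (Suc L)
  then show ?case by (cases "i = L") (auto simp: twist_exponent_def)
qed (simp add: twist_exponent_def)

text \<open>At the first index \<open>i\<close> where \<open>y\<close> and \<open>y'\<close> differ, the sums differ by \<open>(i + 1)!\<close> modulo \<open>(i + 2)!\<close>,
  as all later terms are multiples of \<open>(i + 2)!\<close>.\<close>
lemma twist_exponent_inj:
  assumes eq: "\<And>i. twist_exponent (fact (i + 2) - 1) y mod fact (i + 2) =
      twist_exponent (fact (i + 2) - 1) y' mod fact (i + 2)"
  shows "y = y'"
proof (rule ccontr)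
  assume "y \<noteq> y'"
  then have ex: "\<exists>i. y i \<noteq> y' i" by auto
  define i where "i = (LEAST i. y i \<noteq> y' i)"
  have i: "y i \<noteq> y' i" unfolding i_def by (rule LeastI_ex[OF ex])
  have less: "y j = y' j" if "j < i" for j using not_less_Least[of j "\<lambda>i. y i \<noteq> y' i"] that by (auto simp: i_def)
  define K :: nat where "K = fact (i + 2)"
  define c where "c = twist_exponent i y"
  have S: "twist_exponent (Suc n) u = twist_exponent n u + (if u n then fact (Suc n) else 0)" for n u
    by (simp add: twist_exponent_def)
  have cong: "twist_exponent (Suc i + d) u mod K = twist_exponent (Suc i) u mod K" for d u
  proof (induction d)
    case (Suc d)
    have "K dvd fact (Suc (Suc i + d))" unfolding K_def by (rule fact_dvd) simp
    then have "(twist_exponent (Suc i + d) u + (if u (Suc i + d) then fact (Suc (Suc i + d)) else 0)) mod K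
        = twist_exponent (Suc i + d) u mod K"
      by (auto elim!: dvdE simp del: fact_Suc)
    then show ?case using Suc S[of "Suc i + d" u] by (simp only: add_Suc_right)
  qed simp
  have "Suc i \<le> K - 1" using fact_ge_self[of "i + 2"] unfolding K_def by linarith
  then obtain d where d: "K - 1 = Suc i + d" using le_Suc_ex by blast
  have "twist_exponent i y' = c" unfolding c_def twist_exponent_def using less by (intro sum.cong) auto
  then have "(c + (if y i then fact (Suc i) else 0)) mod K = (c + (if y' i then fact (Suc i) else 0)) mod K"
    using eq[of i] cong[of d y] cong[of d y'] S[of i y] S[of i y'] d unfolding K_def[symmetric] c_def by simp
  then have "(c + fact (Suc i)) mod K = c mod K" using i by (auto split: if_splits)
  then have "K dvd fact (Suc i)"
    using mod_eq_dvd_iff_nat[of c "c + fact (Suc i)" K] by (simp del: fact_Suc)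
  then have "K \<le> fact (Suc i)" by (rule dvd_imp_le) simp
  moreover have "fact (Suc i) < K" unfolding K_def by (rule fact_less_mono) simp_all
  ultimately show False by simp
qed

text \<open>A coordinate is a natural number that codes a word, a shift and a third component, which serves
  only to let every pair of a word and a shift occur infinitely often.\<close>
definition coord_word :: "nat \<Rightarrow> (nat \<times> bool) list" where
  "coord_word m = fst (from_nat m :: (nat \<times> bool) list \<times> nat \<times> nat)"

definition coord_shift :: "nat \<Rightarrow> nat" where
  "coord_shift m = fst (snd (from_nat m :: (nat \<times> bool) list \<times> nat \<times> nat))"

abbreviation coord_size :: "nat \<Rightarrow> nat" where
  "coord_size m \<equiv> length (coord_word m)"

lemma infinite_coords: "infinite {m. coord_word m = w \<and> coord_shift m = k}"
proof -
  have "inj (\<lambda>r::nat. to_nat (w, k, r))" by (rule injI) simp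
  then have "infinite (range (\<lambda>r::nat. to_nat (w, k, r)))" by (simp add: finite_image_iff)
  moreover have "range (\<lambda>r::nat. to_nat (w, k, r)) \<subseteq> {m. coord_word m = w \<and> coord_shift m = k}"
    by (auto simp: coord_word_def coord_shift_def)
  ultimately show ?thesis using finite_subset by blast
qed

text \<open>In a coordinate with word \<open>w\<close> and shift \<open>k\<close> the generators are \<open>a = \<sigma>\<^sub>0\<close>, \<open>b = \<sigma>\<^sub>1 a\<^sup>k\<close> and \<open>b\<^sub>i = \<sigma>\<^sub>i\<close>,
  where \<open>\<sigma>\<close> is \<open>path_perm w\<close>, and \<open>s\<^sub>y\<close> is the power of \<open>a\<close> to the twist exponent. When \<open>k\<close> cancels that
  exponent modulo the order of \<open>a\<close>, the twisted tuple is \<open>\<sigma>\<close> itself.\<close>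
definition local_gen :: "(nat \<Rightarrow> bool) \<Rightarrow> nat \<Rightarrow> nat \<Rightarrow> nat \<Rightarrow> nat" where
  "local_gen y m i = (if i = 1
     then path_perm (coord_word m) 1 \<circ>
       path_perm (coord_word m) 0 ^^ (coord_shift m + twist_exponent (coord_size m) y)
     else path_perm (coord_word m) i)"

definition gen :: "(nat \<Rightarrow> bool) \<Rightarrow> nat \<Rightarrow> (nat \<Rightarrow> nat) \<Rightarrow> (nat \<Rightarrow> nat)" where
  "gen y i z = (\<lambda>m. local_gen y m i (z m))"

lemma gen_apply: "gen y i z m = local_gen y m i (z m)"
  by (simp add: gen_def)

lemma permutes_funpow: "p permutes S \<Longrightarrow> p ^^ k permutes S"
  by (induction k) (auto intro: permutes_compose simp: permutes_id id_def[symmetric])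

lemma local_gen_permutes: "local_gen y m i permutes {..coord_size m}"
  unfolding local_gen_def by (auto intro!: permutes_compose permutes_funpow path_perm_permutes)

lemma bij_coordinatewise:
  fixes p :: "'i \<Rightarrow> 'x \<Rightarrow> 'x"
  assumes "\<And>m. bij (p m)"
  shows "bij (\<lambda>z m. p m (z m))" "inv (\<lambda>z m. p m (z m)) = (\<lambda>z m. inv (p m) (z m))"
proof -
  have a: "inv (p m) (p m x) = x" "p m (inv (p m) x) = x" for m x
    using assms[of m] by (auto simp: bij_is_inj bij_is_surj surj_f_inv_f)
  show "bij (\<lambda>z m. p m (z m))"
    by (rule bij_betw_byWitness[of _ "\<lambda>z m. inv (p m) (z m)"]) (auto simp: a)
  show "inv (\<lambda>z m. p m (z m)) = (\<lambda>z m. inv (p m) (z m))"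
    by (rule inv_equality) (auto simp: a)
qed

lemma bij_local_gen: "bij (local_gen y m i)"
  using local_gen_permutes permutes_bij by blast

lemma inv_gen: "inv (gen y i) z = (\<lambda>m. inv (local_gen y m i) (z m))"
  using bij_coordinatewise(2)[of "\<lambda>m. local_gen y m i", OF bij_local_gen]
  by (simp add: gen_def[abs_def])

lemma bij_gen: "bij (gen y i)"
  using bij_coordinatewise(1)[of "\<lambda>m. local_gen y m i", OF bij_local_gen]
  by (simp add: gen_def[abs_def])

lemma wact_gen: "wact (gen y) w z m = wact (local_gen y m) w (z m)"
proof (induction w)
  case (Cons l w)
  obtain i b where "l = (i, b)" by force
  then show ?case
    using Cons gen_apply[of y i "wact (gen y) w z" m] inv_gen[of y i "wact (gen y) w z"] by simp
qed simp

lemma gen_indep_of_param: "i \<noteq> 1 \<Longrightarrow> gen y i = gen y' i"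
  by (simp add: gen_def[abs_def] local_gen_def)

lemma wact_replicate_True: "wact t (replicate k (i, True)) x = (t i ^^ k) x"
  by (induction k) auto

text \<open>Coordinates of size at most \<open>i\<close> do not see the bit \<open>i\<close> at all, but there \<open>a\<^bsup>(i+1)!\<^esup>\<close> is the identity; so
  one power of \<open>a\<close> accounts for the change in all coordinates simultaneously.\<close>
lemma gen_flip:
  "gen (y(i := True)) 1 z = wact (gen (y(i := False))) ((1, True) # replicate (fact (Suc i)) (0, True)) z"
proof
  fix m
  let ?p = "path_perm (coord_word m) 0" and ?e = "twist_exponent (coord_size m) (y(i := False))"
  have "(?p ^^ (coord_shift m + twist_exponent (coord_size m) (y(i := True)))) x =
      (?p ^^ (coord_shift m + ?e)) ((?p ^^ fact (Suc i)) x)" for x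
  proof (cases "i < coord_size m")
    case True
    have "coord_shift m + twist_exponent (coord_size m) (y(i := True)) = (coord_shift m + ?e) + fact (Suc i)"
      unfolding twist_exponent_flip[of "coord_size m" y i] using True by simp
    then show ?thesis by (simp only: funpow_add o_apply)
  next
    case False
    then have "fact (Suc (coord_size m)) dvd (fact (Suc i) :: nat)" by (intro fact_dvd) simp
    then have "(?p ^^ fact (Suc i)) x = x"
      by (intro funpow_fact_permutes[OF path_perm_permutes]) auto
    then show ?thesis using False twist_exponent_flip[of "coord_size m" y i] by simp
  qed
  then show "gen (y(i := True)) 1 z m =
      wact (gen (y(i := False))) ((1, True) # replicate (fact (Suc i)) (0, True)) z m"
    unfolding wact_gen by (simp add: wact_replicate_True gen_def local_gen_def del: fact_Suc)
qed

lemma funpow_wact_replicate_False: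
  assumes "bij (t i)" shows "(t i ^^ k) (wact t (replicate k (i, False)) x) = x"
proof (induction k arbitrary: x)
  case (Suc k)
  have "(t i ^^ Suc k) (wact t (replicate (Suc k) (i, False)) x) =
      (t i ^^ k) (wact t (replicate k (i, False)) x)"
    unfolding funpow_Suc_right using assms by (simp add: bij_is_surj surj_f_inv_f)
  then show ?case using Suc by simp
qed simp

lemma gen_unflip:
  "gen (y(i := False)) 1 z = wact (gen (y(i := True))) ((1, True) # replicate (fact (Suc i)) (0, False)) z"
proof -
  define k :: nat where "k = fact (Suc i)"
  have "gen (y(i := False)) 0 = gen (y(i := True)) 0" by (rule gen_indep_of_param) simp
  then have *: "(gen (y(i := False)) 0 ^^ k) (wact (gen (y(i := True))) (replicate k (0, False)) x) = x" for x
    using funpow_wact_replicate_False[of "gen (y(i := True))" 0, OF bij_gen] by simp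
  show ?thesis
    unfolding k_def[symmetric] wact.simps if_True gen_flip[of y i]
    unfolding k_def[symmetric] wact_replicate_True * ..
qed

text \<open>For the word \<open>a\<^sup>L\<close> with \<open>L + 1 = (i + 2)!\<close>, the permutation \<open>\<sigma>\<^sub>0\<close> is a full cycle. In such a coordinate
  the image of any point determines the twist exponent modulo \<open>(i + 2)!\<close>.\<close>
lemma gen_param_inj:
  assumes z: "\<And>m. z m \<le> coord_size m" and eq: "gen y 1 z = gen y' 1 z"
  shows "y = y'"
proof (rule twist_exponent_inj)
  fix i
  define L :: nat where "L = fact (i + 2) - 1"
  have L: "Suc L = fact (i + 2)" unfolding L_def by (simp del: fact_Suc)
  define w where "w = replicate L (0::nat, True)"
  define m where "m = to_nat (w, 0::nat, 0::nat)"
  have m: "coord_word m = w" by (simp add: m_def coord_word_def)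
  have lw: "length w = L" by (simp add: w_def)
  have w: "reduced_word w" unfolding reduced_word_def w_def successively_conv_nth by auto
  let ?p = "path_perm w 0"
  have path: "(?p ^^ t) 0 = t" if "t \<le> L" for t
    using path_perm_path[OF w, of t] that lw by (simp add: w_def wact_replicate_True)
  have pw: "?p permutes {..L}" using path_perm_permutes[of w 0] lw by simp
  have "local_gen y m 1 (z m) = local_gen y' m 1 (z m)" using eq by (simp add: gen_def fun_eq_iff)
  then have "(?p ^^ (coord_shift m + twist_exponent L y)) (z m) = (?p ^^ (coord_shift m + twist_exponent L y')) (z m)"
    using permutes_inj[OF path_perm_permutes[of w 1]] by (auto simp: local_gen_def m lw dest: injD)
  then have "(?p ^^ coord_shift m) ((?p ^^ twist_exponent L y) (z m)) = (?p ^^ coord_shift m) ((?p ^^ twist_exponent L y') (z m))"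
    by (simp add: funpow_add)
  then have "(?p ^^ twist_exponent L y) (z m) = (?p ^^ twist_exponent L y') (z m)"
    using inj_fn[OF permutes_inj[OF pw], of "coord_shift m"] by (auto dest: injD)
  then have "(z m + twist_exponent L y) mod Suc L = (z m + twist_exponent L y') mod Suc L"
    using funpow_cyclic_permutation[OF pw path, of "z m"] z[of m] m lw by simp
  then have "twist_exponent L y mod Suc L = twist_exponent L y' mod Suc L"
    by (simp add: nat_mod_eq_iff)
  then show "twist_exponent (fact (i + 2) - 1) y mod fact (i + 2) =
      twist_exponent (fact (i + 2) - 1) y' mod fact (i + 2)"
    unfolding L L_def[symmetric] .
qed

section \<open>Product measures\<close>

lemma emeasure_PiM_pmf_cylinder:
  fixes D :: "nat \<Rightarrow> 'x pmf"
  assumes "finite J"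
  shows "emeasure (PiM UNIV (\<lambda>m. measure_pmf (D m))) {z. \<forall>m\<in>J. z m \<in> A m} =
    (\<Prod>m\<in>J. emeasure (measure_pmf (D m)) (A m))"
proof -
  have "{z. \<forall>m\<in>J. z m \<in> A m} = prod_emb UNIV (\<lambda>m. measure_pmf (D m)) J (Pi\<^sub>E J A)"
    by (auto simp: prod_emb_def PiE_iff extensional_def)
  then show ?thesis
    using emeasure_PiM_emb[of UNIV "\<lambda>m. measure_pmf (D m)" J A] assms
    by (simp add: measure_pmf.prob_space_axioms)
qed

lemma sets_PiM_pmf: "sets (PiM UNIV (\<lambda>m. measure_pmf (D m))) = sets (PiM UNIV (\<lambda>_. count_space UNIV))"
  by (intro sets_PiM_cong) auto

lemma space_PiM_pmf [simp]: "space (PiM UNIV (\<lambda>m. measure_pmf (D m))) = UNIV"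
  by (simp add: space_PiM)

lemma prob_space_PiM_pmf: "prob_space (PiM UNIV (\<lambda>m. measure_pmf (D m)))"
  by (intro prob_space_PiM measure_pmf.prob_space_axioms)

text \<open>By independence the probability is at most \<open>q\<^sup>k\<close> for every \<open>k\<close>.\<close>
lemma AE_PiM_pmf_infinitely_many:
  fixes D :: "nat \<Rightarrow> 'x pmf"
  assumes J: "infinite J" and q: "q < 1" and A: "\<And>m. m \<in> J \<Longrightarrow> measure (measure_pmf (D m)) (A m) \<le> q"
  shows "AE z in PiM UNIV (\<lambda>m. measure_pmf (D m)). \<not> (\<forall>m\<in>J. z m \<in> A m)"
proof -
  let ?N = "PiM UNIV (\<lambda>m. measure_pmf (D m))"
  interpret N: prob_space ?N by (rule prob_space_PiM_pmf)
  have q0: "0 \<le> q"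
  proof -
    obtain m where "m \<in> J" using J by (metis ex_in_conv finite.emptyI)
    then show ?thesis using A[of m] order_trans[OF measure_nonneg] by blast
  qed
  let ?E = "{z. \<forall>m\<in>J. z m \<in> A m}"
  have meas: "Measurable.pred ?N (\<lambda>z. z m \<in> A m)" for m
    by (rule measurable_compose[OF measurable_component_singleton[of m]]) auto
  have E: "?E \<in> sets ?N"
  proof -
    have "Measurable.pred ?N (\<lambda>z. \<forall>m. m \<in> J \<longrightarrow> z m \<in> A m)" using meas by measurable
    then show ?thesis by (simp add: pred_def Ball_def)
  qed
  have le: "N.prob ?E \<le> q ^ k" for k
  proof -
    obtain J' where J': "J' \<subseteq> J" "finite J'" "card J' = k"
      using infinite_arbitrarily_large[OF J] by blast
    let ?E' = "{z. \<forall>m\<in>J'. z m \<in> A m}"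
    have "Measurable.pred ?N (\<lambda>z. \<forall>m. m \<in> J' \<longrightarrow> z m \<in> A m)" using meas by measurable
    then have "?E' \<in> sets ?N" by (simp add: pred_def Ball_def)
    then have "N.prob ?E \<le> N.prob ?E'" using J' by (intro N.finite_measure_mono) auto
    also have "\<dots> = (\<Prod>m\<in>J'. measure (measure_pmf (D m)) (A m))"
      using emeasure_PiM_pmf_cylinder[OF J'(2), of D A]
      by (simp add: N.emeasure_eq_measure measure_pmf.emeasure_eq_measure prod_ennreal prod_nonneg)
    also have "\<dots> \<le> (\<Prod>m\<in>J'. q)" using A J' by (intro prod_mono) auto
    finally show ?thesis using J' by simp
  qed
  have "(\<lambda>k. q ^ k) \<longlonglongrightarrow> 0" using q q0 by (intro LIMSEQ_realpow_zero) auto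
  then have "N.prob ?E \<le> 0" by (rule LIMSEQ_le_const) (use le in auto)
  then have "N.prob ?E = 0" by (simp add: measure_le_0_iff)
  then have "?E \<in> null_sets ?N" using E by (simp add: null_sets_def N.emeasure_eq_measure)
  then show ?thesis by (rule AE_I') auto
qed

lemma AE_PiM_pmf_neq:
  fixes D :: "nat \<Rightarrow> 'x pmf"
  assumes J: "infinite J" and q: "q < 1" and A: "\<And>m x. m \<in> J \<Longrightarrow> measure (measure_pmf (D m)) {x} \<le> q"
  shows "AE z' in PiM UNIV (\<lambda>m. measure_pmf (D m)). z' \<noteq> z"
proof -
  have "AE z' in PiM UNIV (\<lambda>m. measure_pmf (D m)). \<not> (\<forall>m\<in>J. z' m \<in> {z m})"
    by (rule AE_PiM_pmf_infinitely_many[OF J q]) (use A in blast)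
  then show ?thesis by eventually_elim auto
qed

lemma mp_bijections_coordinatewise:
  fixes D :: "nat \<Rightarrow> 'x pmf" and p :: "nat \<Rightarrow> 'x \<Rightarrow> 'x"
  assumes p: "\<And>m. bij (p m)" and D: "\<And>m. map_pmf (p m) (D m) = D m"
  shows "(\<lambda>z m. p m (z m)) \<in> mp_bijections (PiM UNIV (\<lambda>m. measure_pmf (D m)))"
proof -
  let ?N = "PiM UNIV (\<lambda>m. measure_pmf (D m))"
  have meas: "(\<lambda>z m. f m (z m)) \<in> measurable ?N ?N" for f :: "nat \<Rightarrow> 'x \<Rightarrow> 'x"
  proof (rule measurable_PiM_single')
    show "(\<lambda>z. f m (z m)) \<in> measurable ?N (measure_pmf (D m))" for m
      by (rule measurable_compose[OF measurable_component_singleton[of m]]) auto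
  qed simp
  interpret N: prob_space ?N by (rule prob_space_PiM_pmf)
  interpret P: product_prob_space "\<lambda>m. measure_pmf (D m)" UNIV ..
  have "distr ?N ?N (\<lambda>z m. p m (z m)) = ?N"
  proof (rule P.PiM_eq)
    fix J :: "nat set" and F :: "nat \<Rightarrow> 'x set"
    assume J: "finite J"
    have emb: "P.emb UNIV J (Pi\<^sub>E J G) = {z. \<forall>m\<in>J. z m \<in> G m}" for G :: "nat \<Rightarrow> 'x set"
      by (auto simp: prod_emb_def PiE_iff extensional_def)
    have "P.emb UNIV J (Pi\<^sub>E J F) \<in> sets ?N" using J by (intro sets_PiM_I) auto
    then have "emeasure (distr ?N ?N (\<lambda>z m. p m (z m))) (P.emb UNIV J (Pi\<^sub>E J F)) =
        emeasure ?N {z. \<forall>m\<in>J. z m \<in> p m -` F m}"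
      by (simp add: emeasure_distr meas emb)
    also have "\<dots> = (\<Prod>m\<in>J. emeasure (measure_pmf (D m)) (p m -` F m))"
      by (rule emeasure_PiM_pmf_cylinder[OF J])
    also have "\<dots> = (\<Prod>m\<in>J. emeasure (measure_pmf (map_pmf (p m) (D m))) (F m))" by simp
    also have "\<dots> = (\<Prod>m\<in>J. emeasure (measure_pmf (D m)) (F m))" by (simp only: D)
    finally show "emeasure (distr ?N ?N (\<lambda>z m. p m (z m))) (P.emb UNIV J (Pi\<^sub>E J F)) =
        (\<Prod>m\<in>J. emeasure (measure_pmf (D m)) (F m))" .
  qed simp
  then show ?thesis
    using meas[of p] meas[of "\<lambda>m. inv (p m)"] bij_coordinatewise[of p, OF p]
    by (simp add: mp_bijections_def)
qed

text \<open>If \<open>y\<close> and \<open>y'\<close> agree on many bits, the preimages of \<open>E\<close> under \<open>r y\<close> and \<open>r y'\<close> are close in measure.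
  For a set depending on one coordinate they coincide. The property passes to
  complements, and to countable unions by cutting off a tail of small measure, which stays small
  because every \<open>r y\<close> preserves the measure.\<close>
lemma PiM_pmf_small_change:
  fixes D :: "nat \<Rightarrow> 'x pmf" and r :: "(nat \<Rightarrow> bool) \<Rightarrow> (nat \<Rightarrow> 'x) \<Rightarrow> (nat \<Rightarrow> 'x)"
  defines "N \<equiv> PiM UNIV (\<lambda>m. measure_pmf (D m))"
  assumes r: "\<And>y. r y \<in> measurable N N" "\<And>y. distr N N (r y) = N"
    and loc: "\<And>m. \<exists>k. \<forall>y y' z. (\<forall>i<k. y i = y' i) \<longrightarrow> r y z m = r y' z m"
    and E: "E \<in> sets N" and \<epsilon>: "\<epsilon> > 0"
  shows "\<exists>k. \<forall>y y'. (\<forall>i<k. y i = y' i) \<longrightarrow> measure N {z. (r y z \<in> E) \<noteq> (r y' z \<in> E)} < \<epsilon>"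
proof -
  interpret N: prob_space N unfolding N_def by (rule prob_space_PiM_pmf)
  have sp: "space N = UNIV" by (simp add: N_def)
  have pre: "{z. r y z \<in> F} \<in> sets N" "N.prob {z. r y z \<in> F} = N.prob F" if "F \<in> sets N" for F y
  proof -
    have eq: "{z. r y z \<in> F} = r y -` F \<inter> space N" by (auto simp: sp)
    show "{z. r y z \<in> F} \<in> sets N" unfolding eq using r(1) that by (rule measurable_sets)
    show "N.prob {z. r y z \<in> F} = N.prob F"
      unfolding eq using measure_distr[OF r(1) that, of y] r(2) by simp
  qed
  have dif: "{z. (r y z \<in> F) \<noteq> (r y' z \<in> F)} \<in> sets N" if "F \<in> sets N" for F y y'
  proof -
    have "{z. (r y z \<in> F) \<noteq> (r y' z \<in> F)} =
        ({z. r y z \<in> F} - {z. r y' z \<in> F}) \<union> ({z. r y' z \<in> F} - {z. r y z \<in> F})" by auto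
    then show ?thesis using pre(1)[OF that] by auto
  qed
  have sN: "sets N = sigma_sets UNIV {{z. z i \<in> A} | i A. True}"
    unfolding N_def sets_PiM_single by (auto simp: PiE_def extensional_def intro!: arg_cong2[where f=sigma_sets])
  have gen: "sigma_sets UNIV {{z. z i \<in> A} | i A. True} \<subseteq> sets N" using sN by simp
  from E have "E \<in> sigma_sets UNIV {{z. z i \<in> A} | i A. True}" using sN by simp
  then have "\<forall>\<epsilon>>0. \<exists>k. \<forall>y y'. (\<forall>i<k. y i = y' i) \<longrightarrow> N.prob {z. (r y z \<in> E) \<noteq> (r y' z \<in> E)} < \<epsilon>"
  proof induction
    case (Basic E)
    then obtain m A where E: "E = {z. z m \<in> A}" by blast
    obtain k where k: "\<And>y y' z. (\<forall>i<k. y i = y' i) \<Longrightarrow> r y z m = r y' z m" using loc by blast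
    have "N.prob {z. (r y z \<in> E) \<noteq> (r y' z \<in> E)} = 0" if "\<forall>i<k. y i = y' i" for y y'
    proof -
      have "{z. (r y z \<in> E) \<noteq> (r y' z \<in> E)} = {}" using k[OF that] by (simp add: E)
      then show ?thesis by simp
    qed
    then show ?case by (intro allI impI exI[of _ k]) simp
  next
    case Empty
    then show ?case by simp
  next
    case (Compl E)
    then show ?case by simp
  next
    case (Union E)
    have Es: "E n \<in> sets N" for n using Union(1)[of n] gen by blast
    show ?case
    proof (intro allI impI)
      fix \<epsilon> :: real assume \<epsilon>: "\<epsilon> > 0"
      define F where "F n = (\<Union>i<n. E i)" for n
      have Fs: "F n \<in> sets N" for n unfolding F_def using Es by auto
      have Us: "(\<Union>n. E n) \<in> sets N" using Es by auto
      have "(\<lambda>n. N.prob (F n)) \<longlonglongrightarrow> N.prob (\<Union>n. F n)"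
      proof (rule N.finite_Lim_measure_incseq)
        show "incseq F" unfolding incseq_def F_def by (intro allI impI UN_mono) auto
      qed (use Fs in auto)
      moreover have "(\<Union>n. F n) = (\<Union>n. E n)" by (auto simp: F_def)
      ultimately have "\<forall>\<^sub>F n in sequentially. N.prob (F n) > N.prob (\<Union>n. E n) - \<epsilon> / 3"
        using \<epsilon> by (intro order_tendstoD(1)) auto
      then obtain n where n: "N.prob (F n) > N.prob (\<Union>n. E n) - \<epsilon> / 3"
        using eventually_happens'[OF sequentially_bot] by blast
      define R where "R = (\<Union>n. E n) - F n"
      have R: "R \<in> sets N" unfolding R_def using Fs Us by auto
      have "F n \<subseteq> (\<Union>n. E n)" by (auto simp: F_def)
      then have Rle: "N.prob R < \<epsilon> / 3"
        unfolding R_def using n by (subst N.finite_measure_Diff[OF Us Fs]) auto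
      define \<delta> where "\<delta> = \<epsilon> / (3 * (real n + 1))"
      have \<delta>: "\<delta> > 0" "real n * \<delta> \<le> \<epsilon> / 3" using \<epsilon> by (auto simp: \<delta>_def field_simps)
      have "\<forall>i. \<exists>k. \<forall>y y'. (\<forall>j<k. y j = y' j) \<longrightarrow> N.prob {z. (r y z \<in> E i) \<noteq> (r y' z \<in> E i)} < \<delta>"
        using Union(2) \<delta>(1) by blast
      from choice[OF this] obtain k where k: "\<forall>i y y'. (\<forall>j<k i. y j = y' j) \<longrightarrow>
          N.prob {z. (r y z \<in> E i) \<noteq> (r y' z \<in> E i)} < \<delta>" by blast
      define K where "K = (\<Sum>i<n. k i)"
      have kK: "k i \<le> K" if "i < n" for i unfolding K_def using that by (intro member_le_sum) auto
      show "\<exists>k. \<forall>y y'. (\<forall>i<k. y i = y' i) \<longrightarrow>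
          N.prob {z. (r y z \<in> (\<Union>n. E n)) \<noteq> (r y' z \<in> (\<Union>n. E n))} < \<epsilon>"
      proof (intro exI[of _ K] allI impI)
        fix y y' :: "nat \<Rightarrow> bool" assume yy': "\<forall>i<K. y i = y' i"
        let ?d = "\<lambda>i. {z. (r y z \<in> E i) \<noteq> (r y' z \<in> E i)}"
        let ?U = "\<Union>i<n. ?d i"
        have ds: "?d i \<in> sets N" for i by (rule dif[OF Es])
        have sub: "{z. (r y z \<in> (\<Union>n. E n)) \<noteq> (r y' z \<in> (\<Union>n. E n))} \<subseteq>
            ?U \<union> ({z. r y z \<in> R} \<union> {z. r y' z \<in> R})"
          by (auto simp: R_def F_def)
        have "N.prob {z. (r y z \<in> (\<Union>n. E n)) \<noteq> (r y' z \<in> (\<Union>n. E n))} \<le>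
            N.prob (?U \<union> ({z. r y z \<in> R} \<union> {z. r y' z \<in> R}))"
          using ds pre(1)[OF R] by (intro N.finite_measure_mono sub) auto
        also have "\<dots> \<le> N.prob ?U + N.prob ({z. r y z \<in> R} \<union> {z. r y' z \<in> R})"
          using ds pre(1)[OF R] by (intro measure_Un_le) auto
        also have "N.prob ({z. r y z \<in> R} \<union> {z. r y' z \<in> R}) \<le> N.prob {z. r y z \<in> R} + N.prob {z. r y' z \<in> R}"
          using pre(1)[OF R] by (intro measure_Un_le) auto
        also have "N.prob {z. r y z \<in> R} + N.prob {z. r y' z \<in> R} = 2 * N.prob R"
          using pre(2)[OF R] by simp
        also have "N.prob ?U \<le> (\<Sum>i<n. N.prob (?d i))"
          using ds by (intro N.finite_measure_subadditive_finite) auto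
        also have "(\<Sum>i<n. N.prob (?d i)) \<le> (\<Sum>i<n. \<delta>)"
        proof (rule sum_mono)
          fix i assume "i \<in> {..<n}"
          then have "\<forall>j<k i. y j = y' j" using kK[of i] yy' by auto
          then show "N.prob (?d i) \<le> \<delta>" using k less_imp_le by blast
        qed
        also have "(\<Sum>i<n. \<delta>) = real n * \<delta>" by simp
        finally show "N.prob {z. (r y z \<in> (\<Union>n. E n)) \<noteq> (r y' z \<in> (\<Union>n. E n))} < \<epsilon>"
          using \<delta>(2) Rle by linarith
      qed
    qed
  qed
  then show ?thesis using \<epsilon> by blast
qed

text \<open>Needed for the Borel sets of the space of bit sequences to be those of the product measure.\<close>
instance bool :: second_countable_topology
proof
  show "\<exists>B::bool set set. countable B \<and> open = generate_topology B"
    by (intro exI[of _ "range lessThan \<union> range greaterThan"]) (auto simp: open_bool_def)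
qed

definition coin :: "(nat \<Rightarrow> bool) measure" where
  "coin = PiM UNIV (\<lambda>_. measure_pmf (pmf_of_set UNIV))"

lemma prob_space_coin: "prob_space coin"
  unfolding coin_def by (rule prob_space_PiM_pmf)

lemma space_coin [simp]: "space coin = UNIV"
  by (simp add: coin_def)

lemma sets_coin: "sets coin = sets borel"
proof -
  have "sets coin = sets (PiM UNIV (\<lambda>_::nat. borel :: bool measure))"
    unfolding coin_def by (intro sets_PiM_cong) (auto simp: sets_borel_eq_count_space)
  then show ?thesis by (simp add: sets_PiM_equal_borel)
qed

lemma AE_coin_neq: "AE y' in coin. y' \<noteq> y"
  unfolding coin_def
  by (rule AE_PiM_pmf_neq[of UNIV "1/2"]) (auto simp: measure_pmf_of_set)

text \<open>Membership of \<open>y\<close> in \<open>A\<close> is unaffected by replacing the first \<open>n\<close> bits by zeros, so \<open>A\<close> is the preimage of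
  itself under a map that depends only on the later bits. Hence \<open>A\<close> is a tail event.\<close>
lemma coin_0_1_law:
  assumes A: "A \<in> sets coin" and flip: "\<And>y i. y(i := True) \<in> A \<longleftrightarrow> y(i := False) \<in> A"
  shows "measure coin A = 0 \<or> measure coin A = 1"
proof -
  let ?D = "\<lambda>_::nat. measure_pmf (pmf_of_set (UNIV::bool set))"
  interpret prob_space coin by (rule prob_space_coin)
  interpret P: product_prob_space ?D UNIV ..
  define F where "F i = {(\<lambda>y. y i) -` B \<inter> space coin | B. B \<in> sets (?D i)}" for i :: nat
  have coord: "(\<lambda>y. y i) \<in> measurable coin (?D i)" for i
    unfolding coin_def by (rule measurable_component_singleton) simp
  have sa: "sigma_algebra (space coin) (F i)" for i
  proof -
    have "F i = sets (vimage_algebra UNIV (\<lambda>y. y i) (?D i))"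
      unfolding F_def by (subst sets_vimage_algebra2) auto
    then show ?thesis using sets.sigma_algebra_axioms[of "vimage_algebra UNIV (\<lambda>y. y i) (?D i)"] by simp
  qed
  have "indep_vars ?D (\<lambda>i y. y i) UNIV"
  proof (subst indep_vars_iff_distr_eq_PiM)
    have "distr coin (Pi\<^sub>M UNIV ?D) (\<lambda>x. \<lambda>i\<in>UNIV. x i) = coin"
      unfolding coin_def by (simp add: restrict_UNIV)
    also have "coin = (\<Pi>\<^sub>M i\<in>UNIV. distr coin (?D i) (\<lambda>y. y i))"
      unfolding coin_def by (intro PiM_cong refl P.PiM_component[symmetric]) simp
    finally show "distr coin (Pi\<^sub>M UNIV ?D) (\<lambda>x. \<lambda>i\<in>UNIV. x i) = (\<Pi>\<^sub>M i\<in>UNIV. distr coin (?D i) (\<lambda>y. y i))" .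
  qed (use coord in simp_all)
  then have indep: "indep_sets F UNIV" unfolding indep_vars_def2 F_def by simp
  have "A \<in> tail_events F"
    unfolding tail_events_def
  proof
    fix n
    let ?S = "sigma (space coin) (\<Union>(F ` {n..}))"
    have sub: "\<Union>(F ` {n..}) \<subseteq> Pow (space coin)" by auto
    define tr where "tr y = (\<lambda>i. if i < n then False else y i)" for y :: "nat \<Rightarrow> bool"
    have inv: "(\<lambda>i. if i < k then False else y i) \<in> A \<longleftrightarrow> y \<in> A" for y :: "nat \<Rightarrow> bool" and k
    proof (induction k)
      case (Suc k)
      define u where "u = (\<lambda>i. if i < k then False else y i)"
      have "(\<lambda>i. if i < Suc k then False else y i) = u(k := False)"
        by (auto simp: fun_eq_iff less_Suc_eq u_def)
      moreover have "u(k := False) \<in> A \<longleftrightarrow> u \<in> A"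
        using flip[of u k] fun_upd_triv[of u k] by (cases "u k") simp_all
      moreover have "u \<in> A \<longleftrightarrow> y \<in> A" using Suc by (simp only: u_def)
      ultimately show ?case by simp
    qed simp
    have "tr \<in> measurable ?S coin"
      unfolding coin_def
    proof (rule measurable_PiM_single')
      fix i
      show "(\<lambda>y. tr y i) \<in> measurable (sigma (space (Pi\<^sub>M UNIV ?D)) (\<Union>(F ` {n..}))) (?D i)"
      proof (cases "i < n")
        case False
        have "(\<lambda>y. y i) -` B \<in> sigma_sets UNIV (\<Union>(F ` {n..}))" for B
          using False by (intro sigma_sets.Basic UN_I[of i]) (auto simp: F_def)
        then show ?thesis
          using False sub by (simp add: tr_def measurable_def sets_measure_of space_measure_of_conv)
      qed (simp add: tr_def)
    qed (simp add: tr_def)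
    from measurable_sets[OF this A] have "tr -` A \<inter> space ?S \<in> sets ?S" .
    moreover have "tr y \<in> A \<longleftrightarrow> y \<in> A" for y using inv[of n y] by (simp only: tr_def)
    then have "tr -` A \<inter> space ?S = A" by (simp add: vimage_def space_measure_of_conv)
    ultimately show "A \<in> sigma_sets (space coin) (\<Union>(F ` {n..}))"
      using sub by (simp add: sets_measure_of)
  qed
  then show ?thesis by (rule kolmogorov_0_1_law[OF sa indep])
qed

lemma coin_AE_constant:
  fixes h :: "(nat \<Rightarrow> bool) \<Rightarrow> (nat \<Rightarrow> bool)"
  assumes h: "h \<in> borel_measurable coin" and flip: "\<And>y i. h (y(i := True)) = h (y(i := False))"
  shows "\<exists>c. AE y in coin. h y = c"
proof -
  interpret prob_space coin by (rule prob_space_coin)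
  define A where "A j = {y. h y j}" for j
  have [measurable]: "(\<lambda>y. h y j) \<in> measurable coin (count_space UNIV)" for j
  proof -
    have "(\<lambda>u::nat \<Rightarrow> bool. u j) \<in> borel_measurable borel"
      by (intro borel_measurable_continuous_onI continuous_on_product_coordinates)
    from measurable_compose[OF h this] show ?thesis
      using measurable_cong_sets[OF refl sets_borel_eq_count_space[where 'a=bool]] by blast
  qed
  have Am: "A j \<in> sets coin" for j
  proof -
    have "Measurable.pred coin (\<lambda>y. h y j)" by simp
    then show ?thesis by (simp add: A_def pred_def)
  qed
  have 01: "prob (A j) = 0 \<or> prob (A j) = 1" for j
    by (rule coin_0_1_law[OF Am]) (simp add: A_def flip)
  have "AE y in coin. h y j = (prob (A j) = 1)" for j
  proof (cases "prob (A j) = 1")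
    case True
    then have "AE y in coin. y \<in> A j" using prob_eq_1[OF Am] by simp
    then show ?thesis using True by (simp add: A_def)
  next
    case False
    then have "prob (A j) = 0" using 01 by blast
    then have "AE y in coin. y \<notin> A j" using prob_eq_0[OF Am] by simp
    then show ?thesis using False by (simp add: A_def)
  qed
  then have "AE y in coin. \<forall>j. h y j = (prob (A j) = 1)" by (simp add: AE_all_countable)
  then have "AE y in coin. h y = (\<lambda>j. prob (A j) = 1)" by eventually_elim auto
  then show ?thesis by blast
qed

definition model :: "(nat \<Rightarrow> nat) measure" where
  "model = PiM UNIV (\<lambda>m. measure_pmf (pmf_of_set {..coord_size m}))"

lemma prob_space_model: "prob_space model"
  unfolding model_def by (rule prob_space_PiM_pmf)

lemma space_model [simp]: "space model = UNIV"
  by (simp add: model_def)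

lemma sets_model: "sets model = sets (PiM UNIV (\<lambda>_. count_space UNIV))"
  unfolding model_def by (rule sets_PiM_pmf)

lemma AE_model_neq: "AE z' in model. z' \<noteq> z"
  unfolding model_def
proof (rule AE_PiM_pmf_neq[OF infinite_coords[of "[(0, True)]" 0]])
  show "measure (measure_pmf (pmf_of_set {..coord_size m})) {x} \<le> 1/2"
    if "m \<in> {m. coord_word m = [(0, True)] \<and> coord_shift m = 0}" for m x
    using that by (auto simp: measure_pmf_of_set card_insert_if Int_insert_right)
qed simp

lemma emeasure_model_singleton: "emeasure model {z} = 0"
proof -
  obtain E where E: "{z' \<in> space model. \<not> z' \<noteq> z} \<subseteq> E" "emeasure model E = 0" "E \<in> sets model"
    using AE_model_neq[of z] by (rule AE_E)
  then have "emeasure model {z} \<le> emeasure model E" by (intro emeasure_mono) auto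
  then show ?thesis using E by simp
qed

lemma AE_model_support: "AE z in model. \<forall>m. z m \<le> coord_size m"
  unfolding AE_all_countable
proof
  fix m
  interpret P: product_prob_space "\<lambda>m. measure_pmf (pmf_of_set {..coord_size m})" UNIV ..
  have "AE x in measure_pmf (pmf_of_set {..coord_size m}). x \<le> coord_size m"
    by (simp add: AE_measure_pmf_iff)
  then show "AE z in model. z m \<le> coord_size m"
    unfolding model_def by (rule P.AE_component[rotated]) simp
qed

lemma gen_mp_bijections: "gen y i \<in> mp_bijections model"
proof -
  have "map_pmf (local_gen y m i) (pmf_of_set {..coord_size m}) = pmf_of_set {..coord_size m}" for m
    using permutes_imp_bij[OF local_gen_permutes] by (rule map_pmf_of_set_bij_betw) auto
  then show ?thesis
    unfolding model_def gen_def[abs_def]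
    using mp_bijections_coordinatewise[of "\<lambda>m. local_gen y m i" "\<lambda>m. pmf_of_set {..coord_size m}"]
      bij_local_gen by simp
qed

text \<open>In the infinitely many coordinates with word \<open>w\<close> and a shift \<open>k\<close> compensating the twist exponent \<open>e\<close>, the
  generators are the permutations for which \<open>w\<close> maps \<open>0\<close> to \<open>length w\<close>. There \<open>w\<close> moves at least one of
  \<open>length w + 1\<close> points.\<close>
lemma gen_free:
  assumes w: "reduced_word w" "w \<noteq> []"
  shows "AE z in model. wact (gen y) w z \<noteq> z"
proof -
  define e where "e = twist_exponent (length w) y"
  \<comment> \<open>A natural number congruent to \<open>-e\<close> modulo the factorial.\<close>
  define k where "k = e * (fact (Suc (length w)) - 1)"
  have ke: "fact (Suc (length w)) dvd k + e"
  proof -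
    have "k + e = e * fact (Suc (length w))" unfolding k_def
      by (simp add: diff_mult_distrib2 algebra_simps del: fact_Suc)
    then show ?thesis by simp
  qed
  define J where "J = {m. coord_word m = w \<and> coord_shift m = k}"
  define A where "A m = {x. wact (local_gen y m) w x = x}" for m
  define q where "q = real (length w) / (real (length w) + 1)"
  have "AE z in model. \<not> (\<forall>m\<in>J. z m \<in> A m)"
    unfolding model_def
  proof (rule AE_PiM_pmf_infinitely_many)
    show "infinite J" unfolding J_def by (rule infinite_coords)
    show "q < 1" by (simp add: q_def)
    fix m assume "m \<in> J"
    then have m: "coord_word m = w" "coord_shift m = k" by (auto simp: J_def)
    have "local_gen y m i x = path_perm w i x" for i x
      using funpow_fact_permutes[OF path_perm_permutes[of w 0] _ _ ke]
      by (simp add: local_gen_def m e_def[symmetric])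
    then have "local_gen y m = path_perm w" by (simp add: fun_eq_iff)
    then have "wact (local_gen y m) w 0 = length w" using path_perm_path[OF w(1), of "length w"] by simp
    then have "0 \<notin> A m" using w(2) by (simp add: A_def)
    then have "{..length w} \<inter> A m \<subseteq> {1..length w}" using Suc_le_eq by (auto intro: ccontr)
    then have "card ({..length w} \<inter> A m) \<le> card {1..length w}" by (intro card_mono) auto
    then show "measure (measure_pmf (pmf_of_set {..coord_size m})) (A m) \<le> q"
      by (simp add: measure_pmf_of_set m q_def divide_right_mono add.commute)
  qed
  then show ?thesis
  proof eventually_elim
    case (elim z)
    show ?case
    proof
      assume "wact (gen y) w z = z"
      then have "wact (local_gen y m) w (z m) = z m" for m using wact_gen[of y w z m] by simp
      then show False using elim by (simp add: A_def)
    qed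
  qed
qed

lemma twist_exponent_cong: "(\<And>i. i < L \<Longrightarrow> y i = y' i) \<Longrightarrow> twist_exponent L y = twist_exponent L y'"
  unfolding twist_exponent_def by (intro sum.cong) auto

lemma local_gen_cong:
  assumes "\<And>i. i < coord_size m \<Longrightarrow> y i = y' i" shows "local_gen y m = local_gen y' m"
  using twist_exponent_cong[OF assms] by (simp add: local_gen_def fun_eq_iff)

text \<open>The inverses occur because images under \<open>T\<close>, which define the weak topology, are preimages
  under \<open>inv T\<close>.\<close>
lemma gen_small_change:
  assumes E: "E \<in> sets model" and \<epsilon>: "\<epsilon> > 0"
  shows "\<exists>k. \<forall>y y'. (\<forall>i<k. y i = y' i) \<longrightarrow>
    measure model {z. (inv (gen y j) z \<in> E) \<noteq> (inv (gen y' j) z \<in> E)} < \<epsilon>"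
  unfolding model_def
proof (rule PiM_pmf_small_change)
  note g = mp_bijections_inv[OF gen_mp_bijections, unfolded model_def]
  show "inv (gen y j) \<in> measurable (Pi\<^sub>M UNIV (\<lambda>m. measure_pmf (pmf_of_set {..coord_size m})))
      (Pi\<^sub>M UNIV (\<lambda>m. measure_pmf (pmf_of_set {..coord_size m})))" for y
    by (rule mp_bijectionsD(2)[OF g])
  show "distr (Pi\<^sub>M UNIV (\<lambda>m. measure_pmf (pmf_of_set {..coord_size m})))
      (Pi\<^sub>M UNIV (\<lambda>m. measure_pmf (pmf_of_set {..coord_size m}))) (inv (gen y j)) =
      Pi\<^sub>M UNIV (\<lambda>m. measure_pmf (pmf_of_set {..coord_size m}))" for y
    by (rule mp_bijectionsD(4)[OF g])
  show "\<exists>k. \<forall>y y' z. (\<forall>i<k. y i = y' i) \<longrightarrow> inv (gen y j) z m = inv (gen y' j) z m" for m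
    using local_gen_cong[of m] by (intro exI[of _ "coord_size m"]) (metis inv_gen)
qed (use E \<epsilon> in \<open>auto simp: model_def\<close>)

section \<open>The twisted actions on the given space\<close>

definition lifted_gen ::
    "'a measure \<Rightarrow> ('a \<Rightarrow> nat \<Rightarrow> nat) \<Rightarrow> (nat \<Rightarrow> bool) \<Rightarrow> nat \<Rightarrow> 'a \<Rightarrow> 'a" where
  "lifted_gen M \<phi> y i =
    (SOME T. T \<in> mp_bijections M \<and> (AE x in M. \<phi> (T x) = gen y i (\<phi> x)))"

definition twisted_action ::
    "enat \<Rightarrow> 'a measure \<Rightarrow> ('a \<Rightarrow> nat \<Rightarrow> nat) \<Rightarrow> (nat \<Rightarrow> bool) \<Rightarrow> nat \<Rightarrow> ('a \<Rightarrow> 'a) set" where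
  "twisted_action n M \<phi> y = (\<lambda>i\<in>generators n. ae_class M (lifted_gen M \<phi> y i))"

lemma topspace_weak_topology: "topspace (weak_topology M) = MPT M"
proof -
  have "MPT M \<subseteq> \<Union>{weak_nbhd M T \<E> \<epsilon> | T \<E> \<epsilon>. T \<in> MPT M \<and> finite \<E> \<and> \<E> \<subseteq> sets M \<and> \<epsilon> > 0}"
    (is "_ \<subseteq> \<Union>?\<B>")
  proof
    fix C assume C: "C \<in> MPT M"
    then have "weak_nbhd M C {} 1 \<in> ?\<B>" by (intro CollectI exI conjI refl) auto
    then show "C \<in> \<Union>?\<B>" using C by (intro UnionI) (auto simp: weak_nbhd_def)
  qed
  then show ?thesis
    unfolding weak_topology_def topology_generated_by_topspace by (auto simp: weak_nbhd_def)
qed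

lemma prob_space_AE_ex:
  assumes "prob_space M" "AE x in M. Q x" shows "\<exists>x. Q x"
proof (rule ccontr)
  interpret prob_space M by fact
  assume "\<not> (\<exists>x. Q x)"
  then have "AE x in M. False" using assms(2) by simp
  then show False by simp
qed

lemma pred_eq_nat:
  fixes f g :: "'b \<Rightarrow> nat"
  assumes "f \<in> measurable M (count_space UNIV)" "g \<in> measurable M (count_space UNIV)"
  shows "Measurable.pred M (\<lambda>x. f x = g x)"
proof -
  have "f \<in> borel_measurable M" "g \<in> borel_measurable M"
    using assms measurable_cong_sets[OF refl sets_borel_eq_count_space[where 'a=nat]] by blast+
  then show ?thesis by (simp add: pred_def measurable_equality_set)
qed

lemma measurable_component_model:
  assumes "f \<in> measurable K model" shows "(\<lambda>x. f x m) \<in> measurable K (count_space UNIV)"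
proof -
  have "(\<lambda>z. z m) \<in> measurable model (count_space UNIV)"
    using measurable_component_singleton[of m UNIV "\<lambda>_. count_space UNIV"]
      measurable_cong_sets[OF sets_model refl] by blast
  from measurable_compose[OF assms this] show ?thesis .
qed

lemma sets_coin_pair_model_eq:
  assumes w: "t \<in> mp_bijections model"
  shows "Measurable.pred (coin \<Otimes>\<^sub>M model) (\<lambda>p. gen (fst p) 1 (snd p) = t (snd p))"
    and "Measurable.pred model (\<lambda>z. gen y 1 z = t z)"
proof -
  have "Measurable.pred (coin \<Otimes>\<^sub>M model) (\<lambda>p. gen (fst p) 1 (snd p) m = t (snd p) m)" for m
  proof (rule pred_eq_nat)
    have "(\<lambda>p. t (snd p)) \<in> measurable (coin \<Otimes>\<^sub>M model) model"
      using mp_bijectionsD(2)[OF w] by measurable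
    then show "(\<lambda>p. t (snd p) m) \<in> measurable (coin \<Otimes>\<^sub>M model) (count_space UNIV)"
      by (rule measurable_component_model)
    \<comment> \<open>The coordinate depends on the parameter only through the exponent, which has countably many values.\<close>
    define F where "F e x = path_perm (coord_word m) 1 ((path_perm (coord_word m) 0 ^^ (coord_shift m + e)) x)" for e x
    have eq: "gen (fst p) 1 (snd p) m = F (twist_exponent (coord_size m) (fst p)) (snd p m)" for p
      by (simp add: gen_apply local_gen_def F_def)
    have c: "(\<lambda>y. y j) \<in> measurable coin (count_space UNIV)" for j
      using measurable_component_singleton[of j UNIV "\<lambda>_. measure_pmf (pmf_of_set UNIV)"]
      by (simp add: coin_def measurable_pmf_measure2)
    have "(\<lambda>y. twist_exponent L y) \<in> measurable coin (count_space UNIV)" for L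
    proof (induction L)
      case (Suc L)
      have "(\<lambda>y. if y L then fact (Suc L) else 0 :: nat) \<in> measurable coin (count_space UNIV)"
        by (rule measurable_compose[OF c]) simp
      from measurable_compose_countable[OF _ this, of "\<lambda>a y. twist_exponent L y + a"] Suc
      show ?case by (simp add: twist_exponent_def)
    qed (simp add: twist_exponent_def)
    then have e: "(\<lambda>p. twist_exponent (coord_size m) (fst p)) \<in> measurable (coin \<Otimes>\<^sub>M model) (count_space UNIV)"
      by (rule measurable_compose[OF measurable_fst])
    have "(\<lambda>p. snd p m) \<in> measurable (coin \<Otimes>\<^sub>M model) (count_space UNIV)"
      by (rule measurable_component_model) simp
    then have "(\<lambda>p. F a (snd p m)) \<in> measurable (coin \<Otimes>\<^sub>M model) (count_space UNIV)" for a
      by (rule measurable_compose) simp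
    from measurable_compose_countable[OF this e]
    show "(\<lambda>p. gen (fst p) 1 (snd p) m) \<in> measurable (coin \<Otimes>\<^sub>M model) (count_space UNIV)"
      unfolding eq .
  qed
  then show "Measurable.pred (coin \<Otimes>\<^sub>M model) (\<lambda>p. gen (fst p) 1 (snd p) = t (snd p))"
    unfolding fun_eq_iff by measurable
  have "Measurable.pred model (\<lambda>z. gen y 1 z m = t z m)" for m
    by (intro pred_eq_nat measurable_component_model mp_bijectionsD(2) gen_mp_bijections w)
  then show "Measurable.pred model (\<lambda>z. gen y 1 z = t z)"
    unfolding fun_eq_iff by measurable
qed

lemma open_cylinder: "open {y' :: nat \<Rightarrow> bool. \<forall>j<k. y j = y' j}"
proof -
  have "open ((\<lambda>y' :: nat \<Rightarrow> bool. y' j) -` {y j})" for j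
    by (intro open_vimage discrete_topology_class.open_discrete continuous_on_product_coordinates)
  then have "open (\<Inter>j<k. (\<lambda>y' :: nat \<Rightarrow> bool. y' j) -` {y j})" by auto
  moreover have "(\<Inter>j<k. (\<lambda>y' :: nat \<Rightarrow> bool. y' j) -` {y j}) = {y'. \<forall>j<k. y j = y' j}" by auto
  ultimately show ?thesis by simp
qed

lemma image_mp_bijection:
  assumes "T \<in> mp_bijections M" "E \<in> sets M" "space M = UNIV"
  shows "T ` E = {x. inv T x \<in> E}" "T ` E \<in> sets M"
proof -
  have b: "bij T" using assms(1) by (rule mp_bijectionsD)
  show eq: "T ` E = {x. inv T x \<in> E}"
    using b by (auto simp: bij_is_inj) (metis bij_inv_eq_iff imageI)
  have "inv T -` E \<inter> space M \<in> sets M" using mp_bijectionsD(3)[OF assms(1)] assms(2) by (rule measurable_sets)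
  then show "T ` E \<in> sets M" by (simp add: eq assms(3) vimage_def)
qed

context
  fixes M :: "'a::polish_space measure" and \<phi> :: "'a \<Rightarrow> nat \<Rightarrow> nat" and \<psi> :: "(nat \<Rightarrow> nat) \<Rightarrow> 'a" and n :: enat
  assumes prob: "prob_space M" and sets_M: "sets M = sets borel" and iso: "iso_mod0 M model \<phi> \<psi>"
    and two: "2 \<le> n"
begin

lemma space_M: "space M = UNIV"
  using sets_eq_imp_space_eq[OF sets_M] by simp

lemma phi: "\<phi> \<in> measurable M model" "distr M model \<phi> = model"
  and psi: "\<psi> \<in> measurable model M"
  and psi_phi: "AE x in M. \<psi> (\<phi> x) = x"
  using iso by (auto simp: iso_mod0_def)

lemma generators_0_1: "0 \<in> generators n" "1 \<in> generators n"
proof -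
  have "enat 1 < 2" by (simp add: numeral_eq_enat)
  then have "enat 1 < n" using two by (rule less_le_trans)
  then show "0 \<in> generators n" "1 \<in> generators n"
    by (auto simp: generators_def zero_enat_def[symmetric] intro: le_less_trans)
qed

lemma lifted_gen:
  "lifted_gen M \<phi> y i \<in> mp_bijections M" "AE x in M. \<phi> (lifted_gen M \<phi> y i x) = gen y i (\<phi> x)"
proof -
  have "\<exists>T. T \<in> mp_bijections M \<and> (AE x in M. \<phi> (T x) = gen y i (\<phi> x))"
    using lift_along_iso_mod0[OF sets_M iso gen_mp_bijections[of y i]] by blast
  from someI_ex[OF this]
  show "lifted_gen M \<phi> y i \<in> mp_bijections M" "AE x in M. \<phi> (lifted_gen M \<phi> y i x) = gen y i (\<phi> x)"
    unfolding lifted_gen_def by simp_all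
qed

abbreviation rep_gen where "rep_gen y \<equiv> \<lambda>i. rep (twisted_action n M \<phi> y i)"

lemma twisted_action_in_MPT: "i \<in> generators n \<Longrightarrow> twisted_action n M \<phi> y i \<in> MPT M"
  using ae_class_in_MPT[OF lifted_gen(1)] by (simp add: twisted_action_def)

lemma rep_twisted_action:
  assumes i: "i \<in> generators n"
  shows "rep_gen y i \<in> mp_bijections M" "AE x in M. \<phi> (rep_gen y i x) = gen y i (\<phi> x)"
proof -
  show "rep_gen y i \<in> mp_bijections M" using twisted_action_in_MPT[OF i] by (rule rep_in_mp_bijections)
  show "AE x in M. \<phi> (rep_gen y i x) = gen y i (\<phi> x)"
    using AE_rep_ae_class[OF lifted_gen(1)[of y i]] lifted_gen(2)[of y i]
    by eventually_elim (simp add: twisted_action_def i)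
qed

lemma AE_word_twisted_action:
  assumes "fst ` set w \<subseteq> generators n"
  shows "AE x in M. \<phi> (wact (rep_gen y) w x) = wact (gen y) w (\<phi> x)"
  using assms rep_twisted_action bij_gen by (intro AE_wact_intertwine[OF phi]) auto

lemma twisted_action_in_topspace: "twisted_action n M \<phi> y \<in> topspace (actions n M)"
  using twisted_action_in_MPT
  by (auto simp: actions_def topspace_weak_topology twisted_action_def)

lemma twisted_action_in_Fr: "twisted_action n M \<phi> y \<in> Fr n M"
  unfolding Fr_def
proof (intro CollectI conjI twisted_action_in_topspace ballI impI)
  fix w assume w: "w \<in> free_group n" "w \<noteq> []"
  have "AE x in M. wact (gen y) w (\<phi> x) \<noteq> \<phi> x"
    using AE_mp_compose[OF phi gen_free[of w y]] w by (simp add: free_group_eq)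
  moreover have "AE x in M. \<phi> (wact (rep_gen y) w x) = wact (gen y) w (\<phi> x)"
    using w by (intro AE_word_twisted_action) (simp add: free_group_eq)
  ultimately show "AE x in M. act (twisted_action n M \<phi> y) w x \<noteq> x"
    unfolding act_eq_wact by eventually_elim auto
qed

text \<open>Equality of words in the model gives equality of the lifted words almost everywhere, because
  \<open>\<phi>\<close> is almost everywhere injective and words preserve null sets.\<close>
lemma AE_orbit_twisted_action_subset:
  assumes u: "fst ` set u \<subseteq> generators n" and yu: "\<And>z. gen y' 1 z = wact (gen y) u z"
  shows "AE x in M. \<forall>v. (x, v) \<in> orbit_relation n (twisted_action n M \<phi> y') \<longrightarrow>
    (x, v) \<in> orbit_relation n (twisted_action n M \<phi> y)"
proof -
  define sub where "sub i = (if i = 1 then u else [(i, True)])" for i :: nat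
  have gen: "gen y' i z = wact (gen y) (sub i) z" for i z
    using yu gen_indep_of_param[of i y' y] by (simp add: sub_def)
  have sub: "fst ` set (sub i) \<subseteq> generators n" if "i \<in> generators n" for i
    using u that by (auto simp: sub_def)
  have "AE x in M. \<forall>w. fst ` set w \<subseteq> generators n \<longrightarrow>
      (\<exists>w'. fst ` set w' \<subseteq> generators n \<and> reduced_word w' \<and> wact (rep_gen y) w' x = wact (rep_gen y') w x)"
  proof (rule AE_orbit_subset)
    fix i assume i: "i \<in> generators n"
    show "rep_gen y i \<in> mp_bijections M" "rep_gen y' i \<in> mp_bijections M" using i by (rule rep_twisted_action)+
    show "fst ` set (sub i) \<subseteq> generators n" by (rule sub[OF i])
    have m: "wact (rep_gen y) (sub i) \<in> mp_bijections M"
      using sub[OF i] rep_twisted_action(1) by (intro wact_mp_bijections) blast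
    show "AE x in M. rep_gen y' i x = wact (rep_gen y) (sub i) x"
      using rep_twisted_action(2)[OF i, of y'] AE_word_twisted_action[OF sub[OF i], of y]
        AE_mp_bijection[OF m psi_phi] AE_mp_bijection[OF rep_twisted_action(1)[OF i, of y'] psi_phi]
    proof eventually_elim
      case (elim x)
      then have "\<phi> (rep_gen y' i x) = \<phi> (wact (rep_gen y) (sub i) x)" by (simp add: gen)
      then show ?case using elim(3,4) by metis
    qed
  qed
  then show ?thesis
  proof eventually_elim
    case (elim x)
    show ?case
    proof (intro allI impI)
      fix v assume "(x, v) \<in> orbit_relation n (twisted_action n M \<phi> y')"
      then obtain w where "fst ` set w \<subseteq> generators n" "wact (rep_gen y') w x = v"
        by (auto simp: orbit_relation_def act_eq_wact free_group_eq)
      with elim obtain w' where "fst ` set w' \<subseteq> generators n" "reduced_word w'" "wact (rep_gen y) w' x = v" by metis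
      then show "(x, v) \<in> orbit_relation n (twisted_action n M \<phi> y)"
        by (auto simp: orbit_relation_def act_eq_wact free_group_eq)
    qed
  qed
qed

lemma same_orbits_flip:
  "(twisted_action n M \<phi> (y(i := True)), twisted_action n M \<phi> (y(i := False))) \<in> same_orbits n M"
proof -
  let ?t = "twisted_action n M \<phi> (y(i := True))" and ?f = "twisted_action n M \<phi> (y(i := False))"
  have w: "fst ` set ((1, True) # replicate k (0, b)) \<subseteq> generators n" for k b
    using generators_0_1 by auto
  have "AE x in M. \<forall>v. (x, v) \<in> orbit_relation n ?t \<longrightarrow> (x, v) \<in> orbit_relation n ?f"
    using w gen_flip by (rule AE_orbit_twisted_action_subset)
  moreover have "AE x in M. \<forall>v. (x, v) \<in> orbit_relation n ?f \<longrightarrow> (x, v) \<in> orbit_relation n ?t"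
    using w gen_unflip by (rule AE_orbit_twisted_action_subset)
  ultimately have "AE x in M. x \<in> {x. \<forall>v. (x, v) \<in> orbit_relation n ?t \<longleftrightarrow> (x, v) \<in> orbit_relation n ?f}"
    by eventually_elim blast
  then have "rel_eq_ae M (orbit_relation n ?t) (orbit_relation n ?f)"
    unfolding rel_eq_ae_def by (intro exI[of _ "{x. \<forall>v. (x, v) \<in> orbit_relation n ?t \<longleftrightarrow> (x, v) \<in> orbit_relation n ?f}"]) blast
  then show ?thesis using twisted_action_in_Fr by (simp add: same_orbits_def)
qed

text \<open>Equality of orbit relations is only assumed on a conull set \<open>X0\<close>, so it can be applied to \<open>x\<close> and its
  image under the second generator for almost every \<open>x\<close>: both lie in \<open>X0\<close>, as the generator preserves null sets.\<close>
lemma AE_gen_in_orbit: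
  assumes "(twisted_action n M \<phi> y0, twisted_action n M \<phi> y) \<in> same_orbits n M"
  shows "AE z in model. \<exists>w. w \<in> free_group n \<and> gen y 1 z = wact (gen y0) w z"
proof -
  let ?S = "rep_gen y 1"
  have S: "?S \<in> mp_bijections M" "AE x in M. \<phi> (?S x) = gen y 1 (\<phi> x)"
    using rep_twisted_action generators_0_1 by auto
  obtain X0 where X0: "AE x in M. x \<in> X0" and eq: "\<And>x v. x \<in> X0 \<Longrightarrow> v \<in> X0 \<Longrightarrow>
      (x, v) \<in> orbit_relation n (twisted_action n M \<phi> y0) \<longleftrightarrow> (x, v) \<in> orbit_relation n (twisted_action n M \<phi> y)"
    using assms unfolding same_orbits_def rel_eq_ae_def by blast
  have "[(1, True)] \<in> free_group n" using generators_0_1 by (simp add: free_group_eq reduced_word_def)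
  then have orb: "(x, ?S x) \<in> orbit_relation n (twisted_action n M \<phi> y)" for x
    unfolding orbit_relation_def act_eq_wact by (auto intro!: bexI[of _ "[(1, True)]"])
  have all: "AE x in M. \<forall>w. w \<in> free_group n \<longrightarrow> \<phi> (wact (rep_gen y0) w x) = wact (gen y0) w (\<phi> x)"
    unfolding AE_all_countable
  proof
    show "AE x in M. w \<in> free_group n \<longrightarrow> \<phi> (wact (rep_gen y0) w x) = wact (gen y0) w (\<phi> x)" for w
      using AE_word_twisted_action[of w y0] by (cases "w \<in> free_group n") (auto simp: free_group_eq)
  qed
  have AE_M: "AE x in M. \<exists>w. w \<in> free_group n \<and> gen y 1 (\<phi> x) = wact (gen y0) w (\<phi> x)"
    using X0 AE_mp_bijection[OF S(1) X0] S(2) all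
  proof eventually_elim
    case (elim x)
    then have "(x, ?S x) \<in> orbit_relation n (twisted_action n M \<phi> y0)" using eq orb by blast
    then obtain w where "w \<in> free_group n" "wact (rep_gen y0) w x = ?S x"
      by (auto simp: orbit_relation_def act_eq_wact)
    then show ?case using elim by metis
  qed
  have "Measurable.pred model (\<lambda>z. w \<in> free_group n \<and> gen y 1 z = wact (gen y0) w z)" for w
  proof (cases "w \<in> free_group n")
    case True
    have "Measurable.pred model (\<lambda>z. gen y 1 z = wact (gen y0) w z)"
      by (intro sets_coin_pair_model_eq(2) wact_mp_bijections gen_mp_bijections)
    then show ?thesis using True by simp
  qed simp
  then have "Measurable.pred model (\<lambda>z. \<exists>w. w \<in> free_group n \<and> gen y 1 z = wact (gen y0) w z)"
    by measurable
  then have "(AE z in distr M model \<phi>. \<exists>w. w \<in> free_group n \<and> gen y 1 z = wact (gen y0) w z)"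
    using AE_M by (subst AE_distr_iff[OF phi(1)]) (auto simp: pred_def)
  then show ?thesis by (simp only: phi)
qed

text \<open>Fubini's theorem exchanges the quantifiers: a single point \<open>z\<close> would have its images under the second
  generators of almost all parameters in a countable set. As a parameter is determined by the
  image of \<open>z\<close>, almost all parameters would then lie in a countable, hence null, set.\<close>
lemma not_AE_same_orbits:
  "\<not> (AE y in coin. (twisted_action n M \<phi> y0, twisted_action n M \<phi> y) \<in> same_orbits n M)"
proof
  assume *: "AE y in coin. (twisted_action n M \<phi> y0, twisted_action n M \<phi> y) \<in> same_orbits n M"
  interpret coin: prob_space coin by (rule prob_space_coin)
  interpret model: prob_space model by (rule prob_space_model)
  interpret pair_prob_space coin model ..
  let ?P = "\<lambda>y z. \<exists>w. w \<in> free_group n \<and> gen y 1 z = wact (gen y0) w z"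
  from * have "AE y in coin. AE z in model. ?P y z"
    by eventually_elim (rule AE_gen_in_orbit)
  moreover have "Measurable.pred (coin \<Otimes>\<^sub>M model) (\<lambda>p. ?P (fst p) (snd p))"
  proof -
    have "Measurable.pred (coin \<Otimes>\<^sub>M model) (\<lambda>p. w \<in> free_group n \<and> gen (fst p) 1 (snd p) = wact (gen y0) w (snd p))" for w
    proof (cases "w \<in> free_group n")
      case True
      have "Measurable.pred (coin \<Otimes>\<^sub>M model) (\<lambda>p. gen (fst p) 1 (snd p) = wact (gen y0) w (snd p))"
        by (intro sets_coin_pair_model_eq(1) wact_mp_bijections gen_mp_bijections)
      then show ?thesis using True by simp
    qed simp
    then show ?thesis by measurable
  qed
  ultimately have "AE z in model. AE y in coin. ?P y z"
    by (subst (asm) AE_commute) (auto simp: pred_def)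
  then have "AE z in model. (AE y in coin. ?P y z) \<and> (\<forall>m. z m \<le> coord_size m)"
    using AE_model_support by eventually_elim simp
  then obtain z where z: "AE y in coin. ?P y z" "\<And>m. z m \<le> coord_size m"
    using prob_space_AE_ex[OF prob_space_model] by blast
  have "AE y in coin. \<forall>w. gen y 1 z \<noteq> wact (gen y0) w z"
    unfolding AE_all_countable
  proof
    fix w
    show "AE y in coin. gen y 1 z \<noteq> wact (gen y0) w z"
    proof (cases "\<exists>y1. gen y1 1 z = wact (gen y0) w z")
      case True
      then obtain y1 where y1: "gen y1 1 z = wact (gen y0) w z" by blast
      show ?thesis
        using AE_coin_neq[of y1] by eventually_elim (use gen_param_inj[OF z(2), of _ y1] y1 in metis)
    qed auto
  qed
  with z(1) have "AE y in coin. False" by eventually_elim blast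
  then show False by simp
qed

text \<open>The triangle inequality for symmetric differences, with the distance between the two images
  computed in the model.\<close>
lemma measure_image_twisted_action_le:
  assumes i: "i \<in> generators n" and E: "E \<in> sets M" and D: "D \<in> sets M"
  shows "measure M ((D - rep_gen y' i ` E) \<union> (rep_gen y' i ` E - D)) \<le>
    measure M ((D - rep_gen y i ` E) \<union> (rep_gen y i ` E - D)) +
    measure model {z. (inv (gen y i) z \<in> \<psi> -` E) \<noteq> (inv (gen y' i) z \<in> \<psi> -` E)}"
proof -
  interpret prob_space M by (rule prob)
  have s: "rep_gen u i \<in> mp_bijections M" for u by (rule rep_twisted_action(1)[OF i])
  have im: "rep_gen u i ` E = {x. inv (rep_gen u i) x \<in> E}" "rep_gen u i ` E \<in> sets M" for u
    using image_mp_bijection[OF s E space_M] by auto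
  have pE: "\<psi> -` E \<in> sets model" using measurable_sets[OF psi E] by simp
  have gE: "Measurable.pred model (\<lambda>z. inv (gen u i) z \<in> \<psi> -` E)" for u
    by (rule pred_sets2[OF pE mp_bijectionsD(3)[OF gen_mp_bijections]])
  let ?B = "{z. (inv (gen y i) z \<in> \<psi> -` E) \<noteq> (inv (gen y' i) z \<in> \<psi> -` E)}"
  have "Measurable.pred model (\<lambda>z. (inv (gen y i) z \<in> \<psi> -` E) \<noteq> (inv (gen y' i) z \<in> \<psi> -` E))"
    by (intro pred_intros_logic gE)
  then have B: "?B \<in> sets model" by (simp add: pred_def)
  have inv: "AE x in M. inv (rep_gen u i) x \<in> E \<longleftrightarrow> inv (gen u i) (\<phi> x) \<in> \<psi> -` E" for u
  proof -
    have "AE x in M. \<phi> (inv (rep_gen u i) x) = inv (gen u i) (\<phi> x)"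
      using AE_word_twisted_action[of "[(i, False)]" u] i by simp
    then show ?thesis using AE_mp_bijection[OF mp_bijections_inv[OF s[of u]] psi_phi]
      by eventually_elim (metis vimage_eq)
  qed
  let ?d = "(rep_gen y i ` E - rep_gen y' i ` E) \<union> (rep_gen y' i ` E - rep_gen y i ` E)"
  have "measure M ?d = measure M (\<phi> -` ?B \<inter> space M)"
  proof (rule finite_measure_eq_AE)
    show "AE x in M. (x \<in> ?d) = (x \<in> \<phi> -` ?B \<inter> space M)"
      using inv[of y] inv[of y'] by eventually_elim (auto simp: im(1) space_M)
    show "\<phi> -` ?B \<inter> space M \<in> sets M" using phi(1) B by (rule measurable_sets)
  qed (use im(2) in auto)
  also have "\<dots> = measure model ?B"
    using measure_distr[OF phi(1) B] phi(2) by simp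
  finally have d: "measure M ?d = measure model ?B" .
  have "measure M ((D - rep_gen y' i ` E) \<union> (rep_gen y' i ` E - D)) \<le>
      measure M (((D - rep_gen y i ` E) \<union> (rep_gen y i ` E - D)) \<union> ?d)"
    using im(2) D by (intro finite_measure_mono) auto
  also have "\<dots> \<le> measure M ((D - rep_gen y i ` E) \<union> (rep_gen y i ` E - D)) + measure M ?d"
    using im(2) D by (intro measure_Un_le) auto
  finally show ?thesis unfolding d .
qed

text \<open>Continuity, rather than measurability, is shown because the Borel sets of the space of actions
  are generated by all open sets, not only by the basic ones, whereas continuity can be
  tested on a subbasis.\<close>
lemma continuous_map_twisted_action:
  "continuous_map euclidean (actions n M) (twisted_action n M \<phi>)"
  unfolding actions_def continuous_map_componentwise
proof (intro conjI ballI)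
  show "twisted_action n M \<phi> ` topspace euclidean \<subseteq> extensional (generators n)"
    by (auto simp: twisted_action_def)
  fix i assume i: "i \<in> generators n"
  show "continuous_map euclidean (weak_topology M) (\<lambda>y. twisted_action n M \<phi> y i)"
    unfolding weak_topology_def
  proof (rule continuous_on_generated_topo)
    show "(\<lambda>y. twisted_action n M \<phi> y i) ` topspace euclidean \<subseteq>
        \<Union> {weak_nbhd M T \<E> \<epsilon> |T \<E> \<epsilon>. T \<in> MPT M \<and> finite \<E> \<and> \<E> \<subseteq> sets M \<and> 0 < \<epsilon>}"
      using twisted_action_in_MPT[OF i] topspace_weak_topology[of M]
      unfolding weak_topology_def topology_generated_by_topspace by auto
    fix U assume "U \<in> {weak_nbhd M T \<E> \<epsilon> |T \<E> \<epsilon>. T \<in> MPT M \<and> finite \<E> \<and> \<E> \<subseteq> sets M \<and> 0 < \<epsilon>}"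
    then obtain T \<E> \<epsilon> where U: "U = weak_nbhd M T \<E> \<epsilon>" and T: "T \<in> MPT M" "finite \<E>" "\<E> \<subseteq> sets M"
      by blast
    define d where "d E y = measure M ((rep T ` E - rep_gen y i ` E) \<union> (rep_gen y i ` E - rep T ` E))" for E y
    have "open {y. d E y < \<epsilon>}" if "E \<in> \<E>" for E
    proof (subst open_subopen, rule ballI)
      fix y assume "y \<in> {y. d E y < \<epsilon>}"
      then have y: "\<epsilon> - d E y > 0" by simp
      have E: "E \<in> sets M" using T that by auto
      have D: "rep T ` E \<in> sets M" using image_mp_bijection(2)[OF rep_in_mp_bijections[OF T(1)] E space_M] .
      have pE: "\<psi> -` E \<in> sets model" using measurable_sets[OF psi E] by simp
      obtain k where k: "\<forall>u u'. (\<forall>j<k. u j = u' j) \<longrightarrow>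
          measure model {z. (inv (gen u i) z \<in> \<psi> -` E) \<noteq> (inv (gen u' i) z \<in> \<psi> -` E)} < \<epsilon> - d E y"
        using gen_small_change[OF pE y, of i] by blast
      have "d E y' < \<epsilon>" if "\<forall>j<k. y j = y' j" for y'
        using k[THEN spec, THEN spec, THEN mp, OF that] measure_image_twisted_action_le[OF i E D, of y' y] unfolding d_def by linarith
      then show "\<exists>S. open S \<and> y \<in> S \<and> S \<subseteq> {y. d E y < \<epsilon>}"
        using open_cylinder[of k y] by (intro exI[of _ "{y'. \<forall>j<k. y j = y' j}"]) auto
    qed
    then have "open (\<Inter>E\<in>\<E>. {y. d E y < \<epsilon>})" using T(2) by auto
    moreover have "(\<lambda>y. twisted_action n M \<phi> y i) -` U \<inter> topspace euclidean = (\<Inter>E\<in>\<E>. {y. d E y < \<epsilon>})"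
      using twisted_action_in_MPT[OF i] by (auto simp: U weak_nbhd_def d_def)
    ultimately show "openin euclidean ((\<lambda>y. twisted_action n M \<phi> y i) -` U \<inter> topspace euclidean)"
      by simp
  qed
qed

lemma measurable_twisted_action:
  "twisted_action n M \<phi> \<in> measurable coin (borel_of (subtopology (actions n M) (Fr n M)))"
  unfolding borel_of_def
proof (rule measurable_measure_of)
  let ?T = "subtopology (actions n M) (Fr n M)"
  show "{U. openin ?T U} \<subseteq> Pow (topspace ?T)" using openin_subset by blast
  show "twisted_action n M \<phi> \<in> space coin \<rightarrow> topspace ?T"
    using twisted_action_in_topspace twisted_action_in_Fr by auto
  fix U assume "U \<in> {U. openin ?T U}"
  moreover have "continuous_map euclidean ?T (twisted_action n M \<phi>)"
    using continuous_map_twisted_action twisted_action_in_Fr by (auto intro: continuous_map_into_subtopology)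
  ultimately have "openin euclidean {y \<in> topspace euclidean. twisted_action n M \<phi> y \<in> U}"
    by (intro openin_continuous_map_preimage) auto
  then have "open (twisted_action n M \<phi> -` U)" by (simp add: vimage_def)
  then show "twisted_action n M \<phi> -` U \<inter> space coin \<in> sets coin" by (simp add: sets_coin)
qed

lemma not_smooth_same_orbits:
  "\<not> smooth (borel_of (subtopology (actions n M) (Fr n M))) (same_orbits n M)"
proof
  let ?Y = "borel_of (subtopology (actions n M) (Fr n M))"
  let ?\<theta> = "twisted_action n M \<phi>"
  assume "smooth ?Y (same_orbits n M)"
  then obtain f :: "_ \<Rightarrow> nat \<Rightarrow> bool" where f: "f \<in> borel_measurable ?Y"
    and classify: "\<And>a b. a \<in> space ?Y \<Longrightarrow> b \<in> space ?Y \<Longrightarrow> (a, b) \<in> same_orbits n M \<longleftrightarrow> f a = f b"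
    unfolding smooth_def by blast
  interpret coin: prob_space coin by (rule prob_space_coin)
  have in_Y: "?\<theta> y \<in> space ?Y" for y
    using measurable_space[OF measurable_twisted_action, of y] by simp
  have "\<exists>v. AE y in coin. f (?\<theta> y) = v"
  proof (rule coin_AE_constant)
    show "(\<lambda>y. f (?\<theta> y)) \<in> borel_measurable coin"
      using measurable_twisted_action f by (rule measurable_compose)
    show "f (?\<theta> (y(i := True))) = f (?\<theta> (y(i := False)))" for y i
      using classify[OF in_Y in_Y] same_orbits_flip by blast
  qed
  then obtain v where v: "AE y in coin. f (?\<theta> y) = v" by blast
  then obtain y0 where y0: "f (?\<theta> y0) = v"
    using prob_space_AE_ex[OF prob_space_coin] by blast
  have "AE y in coin. (?\<theta> y0, ?\<theta> y) \<in> same_orbits n M"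
    using v by eventually_elim (simp add: classify[OF in_Y in_Y] y0)
  then show False using not_AE_same_orbits by blast
qed

end

lemma non_atomic_singleton:
  assumes "non_atomic M" "{x} \<in> sets M" shows "emeasure M {x} = 0"
proof (rule ccontr)
  assume "emeasure M {x} \<noteq> 0"
  then obtain B where "B \<subseteq> {x}" "0 < emeasure M B" "emeasure M B < emeasure M {x}"
    using assms unfolding non_atomic_def by (metis zero_less_iff_neq_zero)
  then show False by (auto simp: subset_singleton_iff)
qed

theorem mainTheorem2:
  fixes M :: "'a::polish_space measure" and n :: enat
  assumes "standard_nonatomic_prob_space M"
    and "2 \<le> n"
  shows "\<not> smooth (borel_of (subtopology (actions n M) (Fr n M))) (same_orbits n M)"
proof -
  interpret standard_nonatomic_prob_space M by fact
  have "emeasure M {x} = 0" for x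
    using non_atomic by (rule non_atomic_singleton) (simp add: sets_borel)
  then obtain \<phi> \<psi> where "iso_mod0 M model \<phi> \<psi>"
    using iso_mod0_polish_Baire[OF prob_space_axioms sets_borel _ prob_space_model sets_model
        emeasure_model_singleton] by blast
  then show ?thesis
    using not_smooth_same_orbits[OF prob_space_axioms sets_borel _ assms(2)] by blast
qed

end
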